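(* Let $H_A\cong\mathbb{C}^{d_A}$ and $H_B\cong\mathbb{C}^{d_B}$. Let $\{E^A_{\alpha,k}\}$ ($\alpha=1,\dots,N_A$, $k=1,\dots,M_A$) be an informationally complete $(N_A,M_A)$ POVM on $H_A$ with parameter $x_A$, and $\{E^B_{\beta,j}\}$ ($\beta=1,\dots,N_B$, $j=1,\dots,M_B$) an informationally complete $(N_B,M_B)$ POVM on $H_B$ with parameter $x_B$. Let $\mu,\nu\in\mathbb{R}$ and let $l$ be a positive integer. If a bipartite state $\rho_{AB}$ on $H_A\otimes H_B$ is separable, then $$\left\|\mathcal{M}^l_{\mu,\nu}(\rho_{AB})\right\|_{\mathrm{tr}}\le\sqrt{\left(l\mu^2+\frac{(d_A-1)(d_A^2+M_A^2x_A)}{d_AM_A(M_A-1)}\right)\left(l\nu^2+\frac{(d_B-1)(d_B^2+M_B^2x_B)}{d_BM_B(M_B-1)}\right)}.$$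
   Context: An $(N,M)$ POVM on $\mathbb{C}^d$ (with $M\ge 2$) consists of $N$ POVMs $\{E_{\alpha,k}\mid k=1,\dots,M\}$, $\alpha=1,\dots,N$ (each $E_{\alpha,k}\ge0$ and $\sum_k E_{\alpha,k}=I_d$), satisfying $\mathrm{tr}(E_{\alpha,k})=d/M$, $\mathrm{tr}(E_{\alpha,k}^2)=x$, $\mathrm{tr}(E_{\alpha,k}E_{\alpha,l})=\frac{d-Mx}{M(M-1)}$ for $l\ne k$, and $\mathrm{tr}(E_{\alpha,k}E_{\beta,l})=d/M^2$ for $\beta\neq\alpha$, where the parameter $x$ satisfies $\frac{d}{M^2}<x\le\min\{\frac{d^2}{M^2},\frac dM\}$. It is informationally complete if $N(M-1)=d^2-1$. A state $\rho_{AB}$ is separable if $\rho_{AB}=\sum_ip_i\rho_A^i\otimes\rho_B^i$ with $p_i\ge0$, $\sum_ip_i=1$, and $\rho_A^i,\rho_B^i$ density matrices. Notation: $\rho_A=\mathrm{tr}_B\rho_{AB}$, $\rho_B=\mathrm{tr}_A\rho_{AB}$. $\mathcal{P}(\rho_{AB})$ is the $N_AM_A\times N_BM_B$ real matrix with entry $\mathrm{tr}[(E^A_{\alpha,k}\otimes E^B_{\beta,j})\rho_{AB}]$ in row $(\alpha,k)$ and column $(\beta,j)$ (indices ordered lexicographically). $\tau\in\mathbb{R}^{N_AM_A}$ is the column vector with entries $\mathrm{tr}(E^A_{\alpha,k}\rho_A)$ and $\sigma\in\mathbb{R}^{N_BM_B}$ the column vector with entries $\mathrm{tr}(E^B_{\beta,j}\rho_B)$,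 in the same lexicographic order. $J_{l\times l}$ is the $l\times l$ all-ones matrix, and for a column vector $X$, $\omega_l(X)=(X,\dots,X)$ is the matrix with $l$ columns each equal to $X$. Define the block matrix $$\mathcal{M}^l_{\mu,\nu}(\rho_{AB})=\begin{pmatrix}\mu\nu J_{l\times l}&\mu\,\omega_l(\sigma)^T\\ \nu\,\omega_l(\tau)&\mathcal{P}(\rho_{AB})\end{pmatrix}.$$ $\|G\|_{\mathrm{tr}}=\mathrm{tr}\sqrt{G^\dagger G}$ is the trace norm. *)

theory Defs
  imports "Jordan_Normal_Form.Matrix"
begin

(* All indices are 0-based: alpha < N, k < M; the basis of C^dA (x) C^dB is
   indexed by i*dB + j  (i < dA, j < dB); the pair (alpha,k) is the
   lexicographic index alpha*M + k. *)

definition ctrace :: "complex mat \<Rightarrow> complex" where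
  "ctrace A = (\<Sum>i<dim_row A. A $$ (i,i))"

definition rtrace :: "real mat \<Rightarrow> real" where
  "rtrace A = (\<Sum>i<dim_row A. A $$ (i,i))"

definition cadj :: "complex mat \<Rightarrow> complex mat" where
  "cadj A = mat (dim_col A) (dim_row A) (\<lambda>(i,j). cnj (A $$ (j,i)))"

definition cpsd :: "nat \<Rightarrow> complex mat \<Rightarrow> bool" where
  "cpsd d A \<longleftrightarrow> A \<in> carrier_mat d d \<and> cadj A = A \<and>
     (\<forall>v :: nat \<Rightarrow> complex.
        0 \<le> Re (\<Sum>i<d. \<Sum>j<d. cnj (v i) * A $$ (i,j) * v j))"

definition density :: "nat \<Rightarrow> complex mat \<Rightarrow> bool" where
  "density d \<rho> \<longleftrightarrow> cpsd d \<rho> \<and> ctrace \<rho> = 1"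

definition kron :: "complex mat \<Rightarrow> complex mat \<Rightarrow> complex mat" where
  "kron A B = mat (dim_row A * dim_row B) (dim_col A * dim_col B)
     (\<lambda>(i,j). A $$ (i div dim_row B, j div dim_col B) * B $$ (i mod dim_row B, j mod dim_col B))"

definition ptrace_B :: "nat \<Rightarrow> nat \<Rightarrow> complex mat \<Rightarrow> complex mat" where
  "ptrace_B dA dB \<rho> = mat dA dA (\<lambda>(i,i'). \<Sum>j<dB. \<rho> $$ (i*dB + j, i'*dB + j))"

definition ptrace_A :: "nat \<Rightarrow> nat \<Rightarrow> complex mat \<Rightarrow> complex mat" where
  "ptrace_A dA dB \<rho> = mat dB dB (\<lambda>(j,j'). \<Sum>i<dA. \<rho> $$ (i*dB + j, i*dB + j'))"

definition separable :: "nat \<Rightarrow> nat \<Rightarrow> complex mat \<Rightarrow> bool" where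
  "separable dA dB \<rho> \<longleftrightarrow> \<rho> \<in> carrier_mat (dA*dB) (dA*dB) \<and>
     (\<exists>(n::nat) (p::nat \<Rightarrow> real) \<rho>A \<rho>B.
        (\<forall>i<n. 0 \<le> p i \<and> density dA (\<rho>A i) \<and> density dB (\<rho>B i)) \<and>
        (\<Sum>i<n. p i) = 1 \<and>
        (\<forall>a<dA*dB. \<forall>b<dA*dB.
           \<rho> $$ (a,b) = (\<Sum>i<n. complex_of_real (p i) * kron (\<rho>A i) (\<rho>B i) $$ (a,b))))"

definition NM_POVM :: "nat \<Rightarrow> nat \<Rightarrow> nat \<Rightarrow> real \<Rightarrow> (nat \<Rightarrow> nat \<Rightarrow> complex mat) \<Rightarrow> bool" where
  "NM_POVM d N M x E \<longleftrightarrow>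
     M \<ge> 2 \<and>
     real d / real M ^ 2 < x \<and> x \<le> min (real d ^ 2 / real M ^ 2) (real d / real M) \<and>
     (\<forall>a<N. \<forall>k<M. cpsd d (E a k)) \<and>
     (\<forall>a<N. \<forall>i<d. \<forall>j<d. (\<Sum>k<M. E a k $$ (i,j)) = (if i = j then 1 else 0)) \<and>
     (\<forall>a<N. \<forall>k<M. ctrace (E a k) = complex_of_real (real d / real M)) \<and>
     (\<forall>a<N. \<forall>k<M. ctrace (E a k * E a k) = complex_of_real x) \<and>
     (\<forall>a<N. \<forall>k<M. \<forall>l<M. l \<noteq> k \<longrightarrow>
        ctrace (E a k * E a l) = complex_of_real ((real d - real M * x) / (real M * (real M - 1)))) \<and>
     (\<forall>a<N. \<forall>b<N. \<forall>k<M. \<forall>l<M. b \<noteq> a \<longrightarrow>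
        ctrace (E a k * E b l) = complex_of_real (real d / real M ^ 2))"

definition IC_POVM :: "nat \<Rightarrow> nat \<Rightarrow> nat \<Rightarrow> real \<Rightarrow> (nat \<Rightarrow> nat \<Rightarrow> complex mat) \<Rightarrow> bool" where
  "IC_POVM d N M x E \<longleftrightarrow> NM_POVM d N M x E \<and> N * (M - 1) = d^2 - 1"

definition rpsd :: "real mat \<Rightarrow> bool" where
  "rpsd A \<longleftrightarrow> A \<in> carrier_mat (dim_row A) (dim_row A) \<and> transpose_mat A = A \<and>
     (\<forall>v :: nat \<Rightarrow> real. 0 \<le> (\<Sum>i<dim_row A. \<Sum>j<dim_row A. v i * A $$ (i,j) * v j))"

definition psd_sqrt :: "real mat \<Rightarrow> real mat" where
  "psd_sqrt A = (THE B. rpsd B \<and> B * B = A)"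

definition trace_norm :: "real mat \<Rightarrow> real" where
  "trace_norm G = rtrace (psd_sqrt (transpose_mat G * G))"

definition Pmat :: "nat \<Rightarrow> nat \<Rightarrow> (nat \<Rightarrow> nat \<Rightarrow> complex mat) \<Rightarrow>
    nat \<Rightarrow> nat \<Rightarrow> (nat \<Rightarrow> nat \<Rightarrow> complex mat) \<Rightarrow> complex mat \<Rightarrow> real mat" where
  "Pmat NA MA EA NB MB EB \<rho> = mat (NA*MA) (NB*MB)
     (\<lambda>(r,c). Re (ctrace (kron (EA (r div MA) (r mod MA)) (EB (c div MB) (c mod MB)) * \<rho>)))"

definition tauvec :: "nat \<Rightarrow> nat \<Rightarrow> (nat \<Rightarrow> nat \<Rightarrow> complex mat) \<Rightarrow> complex mat \<Rightarrow> nat \<Rightarrow> real" where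
  "tauvec N M E \<rho>A r = Re (ctrace (E (r div M) (r mod M) * \<rho>A))"

definition Mblock :: "nat \<Rightarrow> real \<Rightarrow> real \<Rightarrow> nat \<Rightarrow> nat \<Rightarrow> (nat \<Rightarrow> real) \<Rightarrow> (nat \<Rightarrow> real) \<Rightarrow> real mat \<Rightarrow> real mat" where
  "Mblock l \<mu> \<nu> m n \<tau> \<sigma> P = mat (l + m) (l + n) (\<lambda>(r,c).
      if r < l \<and> c < l then \<mu> * \<nu>
      else if r < l then \<mu> * \<sigma> (c - l)
      else if c < l then \<nu> * \<tau> (r - l)
      else P $$ (r - l, c - l))"

end

theory Submission
  imports Defs "HOL-Analysis.Function_Topology" "HOL-Analysis.Convex"
begin

text \<open>A separable state makes the block matrix a convex combination of rank-one matrices \<open>u v\<^sup>T\<close>, where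
  \<open>u = (\<mu>, \<dots>, \<mu>, \<tau>)\<close> and \<open>v = (\<nu>, \<dots>, \<nu>, \<sigma>)\<close> are built from the measurement statistics of the two
  local states, and the trace norm of such a combination is at most the largest \<open>|u| |v|\<close>.
  The norms are controlled by the bound on the index of coincidence: the traceless parts
  \<open>E\<^sub>\<alpha>\<^sub>,\<^sub>k - I/M\<close> of the effects are mutually orthogonal for different \<open>\<alpha>\<close>, and for fixed \<open>\<alpha>\<close>
  they form a simplex, so a Bessel inequality bounds the statistics of a state by its purity,
  which is at most 1.\<close>

subsection \<open>Real inner products and the spectral theorem\<close>

text \<open>The index set is a parameter because the inner product is needed both on
  \<open>{..<n}\<close> and on the index pairs of a \<open>d\<close> by \<open>d\<close> matrix.
  Vectors are total functions whose values outside \<open>I\<close> are ignored.\<close>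

definition ip :: "'i set \<Rightarrow> ('i \<Rightarrow> real) \<Rightarrow> ('i \<Rightarrow> real) \<Rightarrow> real" where
  "ip I u v = (\<Sum>i\<in>I. u i * v i)"

lemma ip_commute: "ip I u v = ip I v u"
  by (simp add: ip_def mult.commute)

lemma ip_cong: "(\<And>i. i \<in> I \<Longrightarrow> u i = u' i) \<Longrightarrow> (\<And>i. i \<in> I \<Longrightarrow> v i = v' i) \<Longrightarrow> ip I u v = ip I u' v'"
  by (simp add: ip_def)

lemma ip_add_right: "ip I u (\<lambda>i. v i + w i) = ip I u v + ip I u w"
  by (simp add: ip_def algebra_simps sum.distrib)

lemma ip_diff_right: "ip I u (\<lambda>i. v i - w i) = ip I u v - ip I u w"
  by (simp add: ip_def algebra_simps sum_subtractf)

lemma ip_scale_right: "ip I u (\<lambda>i. c * v i) = c * ip I u v"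
  by (simp add: ip_def sum_distrib_left algebra_simps)

lemma ip_sum_right: "ip I u (\<lambda>i. \<Sum>t\<in>T. g t i) = (\<Sum>t\<in>T. ip I u (g t))"
  unfolding ip_def sum_distrib_left by (rule sum.swap)

lemma ip_add_left: "ip I (\<lambda>i. v i + w i) u = ip I v u + ip I w u"
  by (simp add: ip_def algebra_simps sum.distrib)

lemma ip_diff_left: "ip I (\<lambda>i. v i - w i) u = ip I v u - ip I w u"
  by (simp add: ip_def algebra_simps sum_subtractf)

lemma ip_scale_left: "ip I (\<lambda>i. c * v i) u = c * ip I v u"
  by (simp add: ip_def sum_distrib_left algebra_simps)

lemma ip_sum_left: "ip I (\<lambda>i. \<Sum>t\<in>T. g t i) u = (\<Sum>t\<in>T. ip I (g t) u)"
  unfolding ip_def sum_distrib_right by (rule sum.swap)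

lemmas ip_linear = ip_add_right ip_diff_right ip_scale_right ip_add_left ip_diff_left ip_scale_left

lemma ip_nonneg: "0 \<le> ip I u u"
  by (simp add: ip_def sum_nonneg)

lemma ip_self_eq_0: "finite I \<Longrightarrow> ip I u u = 0 \<longleftrightarrow> (\<forall>i\<in>I. u i = 0)"
  by (simp add: ip_def sum_nonneg_eq_0_iff)

lemma ip_Cauchy_Schwarz: "(ip I u v)\<^sup>2 \<le> ip I u u * ip I v v"
  using Cauchy_Schwarz_ineq_sum[of u v I] by (simp add: ip_def power2_eq_square)

lemma ip_unit_right: "finite I \<Longrightarrow> j \<in> I \<Longrightarrow> ip I u (\<lambda>i. if i = j then 1 else 0) = u j"
  by (simp add: ip_def if_distrib cong: if_cong)

text \<open>Put S = sum of <F_t,v> F_t. Then <S,v> is the left-hand sum q, and the Gram hypothesis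
  says |S|^2 \<le> K q, so Cauchy-Schwarz gives q^2 \<le> K q |v|^2. The Gram form is only tested on
  the coefficients of \<open>v\<close> itself, which lets the bound apply to families that are not
  orthogonal.\<close>

lemma frame_bound:
  assumes K: "0 \<le> K"
    and gram: "(\<Sum>s\<in>T. \<Sum>t\<in>T. ip I (F s) v * ip I (F t) v * ip I (F s) (F t)) \<le> K * (\<Sum>t\<in>T. (ip I (F t) v)\<^sup>2)"
  shows "(\<Sum>t\<in>T. (ip I (F t) v)\<^sup>2) \<le> K * ip I v v"
proof -
  define q where "q = (\<Sum>t\<in>T. (ip I (F t) v)\<^sup>2)"
  define S where "S = (\<lambda>i. \<Sum>t\<in>T. ip I (F t) v * F t i)"
  have q0: "0 \<le> q" by (simp add: q_def sum_nonneg)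
  have "ip I S v = q"
    by (simp add: S_def q_def ip_sum_left ip_scale_left power2_eq_square)
  moreover have "ip I S S \<le> K * q"
    using gram unfolding S_def q_def ip_sum_left ip_sum_right ip_scale_left ip_scale_right
    by (simp add: sum_distrib_left mult.assoc mult.left_commute)
  ultimately have "q\<^sup>2 \<le> (K * q) * ip I v v"
    by (metis ip_Cauchy_Schwarz ip_nonneg mult_right_mono order_trans)
  then have "q * q \<le> q * (K * ip I v v)" by (simp add: power2_eq_square mult_ac)
  then have "q \<le> K * ip I v v"
    using q0 K ip_nonneg[of I v] by (cases "q = 0") (auto simp: mult_le_cancel_left)
  then show ?thesis by (simp add: q_def)
qed

text \<open>Norms at most 1 are allowed instead of exactly 1, so that zero vectors may occur among
  the \<open>F t\<close>; left singular vectors for the singular value 0 are of this kind.\<close>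

lemma bessel:
  assumes "finite T" and "\<And>s t. s \<in> T \<Longrightarrow> t \<in> T \<Longrightarrow> s \<noteq> t \<Longrightarrow> ip I (F s) (F t) = 0"
    and "\<And>t. t \<in> T \<Longrightarrow> ip I (F t) (F t) \<le> 1"
  shows "(\<Sum>t\<in>T. (ip I (F t) v)\<^sup>2) \<le> ip I v v"
proof -
  have "(\<Sum>s\<in>T. \<Sum>t\<in>T. ip I (F s) v * ip I (F t) v * ip I (F s) (F t))
      = (\<Sum>s\<in>T. (ip I (F s) v)\<^sup>2 * ip I (F s) (F s))"
  proof (rule sum.cong[OF refl])
    fix s assume s: "s \<in> T"
    have "(\<Sum>t\<in>T. ip I (F s) v * ip I (F t) v * ip I (F s) (F t))
        = (\<Sum>t\<in>T. if t = s then (ip I (F s) v)\<^sup>2 * ip I (F s) (F s) else 0)"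
      using s assms(2) by (intro sum.cong) (auto simp: power2_eq_square)
    then show "(\<Sum>t\<in>T. ip I (F s) v * ip I (F t) v * ip I (F s) (F t)) = (ip I (F s) v)\<^sup>2 * ip I (F s) (F s)"
      using s assms(1) by simp
  qed
  also have "\<dots> \<le> (\<Sum>s\<in>T. (ip I (F s) v)\<^sup>2)"
    using assms(3) by (intro sum_mono) (simp add: mult_left_le)
  finally show ?thesis using frame_bound[of 1 I F v T] by simp
qed

text \<open>\<open>R\<close> is the component of the j-th unit vector orthogonal to all
  \<open>w i\<close>, so its squared norm is its own j-th coordinate.\<close>

lemma residual_norm:
  fixes n k :: nat
  assumes on: "\<And>i i'. i < k \<Longrightarrow> i' < k \<Longrightarrow> ip {..<n} (w i) (w i') = (if i = i' then 1 else 0)"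
    and j: "j < n"
  defines "R \<equiv> \<lambda>r. (if r = j then 1 else 0) - (\<Sum>i<k. w i j * w i r)"
  shows "\<And>i. i < k \<Longrightarrow> ip {..<n} (w i) R = 0"
    and "ip {..<n} R R = 1 - (\<Sum>i<k. (w i j)\<^sup>2)"
proof -
  show orth: "ip {..<n} (w i) R = 0" if "i < k" for i
    using that j unfolding R_def ip_diff_right ip_sum_right ip_scale_right
    by (simp add: ip_unit_right on if_distrib[of "(*) _"] cong: if_cong)
  have "ip {..<n} R R = ip {..<n} R (\<lambda>r. if r = j then 1 else 0) - (\<Sum>i<k. w i j * ip {..<n} R (w i))"
    by (subst (2) R_def) (simp add: ip_diff_right ip_sum_right ip_scale_right)
  also have "\<dots> = R j"
    using orth j ip_commute[of "{..<n}" R "w _"] by (simp add: ip_unit_right)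
  finally show "ip {..<n} R R = 1 - (\<Sum>i<k. (w i j)\<^sup>2)" by (simp add: R_def power2_eq_square)
qed

text \<open>This is the trace of the projection onto the orthogonal complement. For k < n it shows
  that some unit vector has a nonzero residual, for k = n that all residuals vanish.\<close>

lemma sum_residual_norms:
  fixes n k :: nat
  assumes on: "\<And>i i'. i < k \<Longrightarrow> i' < k \<Longrightarrow> ip {..<n} (w i) (w i') = (if i = i' then 1 else 0)"
  shows "(\<Sum>j<n. 1 - (\<Sum>i<k. (w i j)\<^sup>2)) = real n - real k"
proof -
  have "(\<Sum>j<n. \<Sum>i<k. (w i j)\<^sup>2) = (\<Sum>i<k. ip {..<n} (w i) (w i))"
    unfolding ip_def power2_eq_square by (rule sum.swap)
  then show ?thesis using on by (simp add: sum_subtractf)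
qed

lemma orthonormal_complete:
  fixes n :: nat
  assumes on: "\<And>i i'. i < n \<Longrightarrow> i' < n \<Longrightarrow> ip {..<n} (w i) (w i') = (if i = i' then 1 else 0)"
    and "j < n" "r < n"
  shows "(\<Sum>i<n. w i j * w i r) = (if r = j then 1 else 0)"
proof -
  define R where "R = (\<lambda>j r. (if r = j then 1 else 0) - (\<Sum>i<n. w i j * w i r))"
  have R: "ip {..<n} (R j) (R j) = 1 - (\<Sum>i<n. (w i j)\<^sup>2)" if "j < n" for j
    unfolding R_def using that by (intro residual_norm(2) on) 
  have "(\<Sum>j<n. ip {..<n} (R j) (R j)) = 0"
    using sum_residual_norms[of n n w, OF on] R by simp
  then have "ip {..<n} (R j) (R j) = 0"
    using \<open>j < n\<close> by (subst (asm) sum_nonneg_eq_0_iff) (auto simp: ip_nonneg)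
  then have "R j r = 0" using \<open>r < n\<close> by (simp add: ip_self_eq_0)
  then show ?thesis by (simp add: R_def)
qed

section \<open>The spectral theorem by maximising the Rayleigh quotient\<close>

lemma compact_box: "compact {x :: nat \<Rightarrow> real. (\<forall>i<n. \<bar>x i\<bar> \<le> 1) \<and> (\<forall>i\<ge>n. x i = 0)}"
proof -
  \<comment> \<open>Pinning the coordinates from n on to 0 turns the box into a full product of
    compact sets, to which Tychonoff's theorem applies.\<close>
  have "{x :: nat \<Rightarrow> real. (\<forall>i<n. \<bar>x i\<bar> \<le> 1) \<and> (\<forall>i\<ge>n. x i = 0)}
      = PiE UNIV (\<lambda>i. if i < n then {-1..1} else {0})"
    by (fastforce simp: PiE_def Pi_def abs_le_iff not_less split: if_splits)
  moreover have "compactin (product_topology (\<lambda>i::nat. euclidean :: real topology) UNIV)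
      (PiE UNIV (\<lambda>i. if i < n then {-1..1} else {0}))"
    by (subst compactin_PiE) auto
  ultimately show ?thesis by (simp add: euclidean_product_topology)
qed

text \<open>Only the number of columns is fixed, so the same operation serves square and rectangular
  matrices.\<close>

definition app :: "nat \<Rightarrow> (nat \<Rightarrow> nat \<Rightarrow> real) \<Rightarrow> (nat \<Rightarrow> real) \<Rightarrow> nat \<Rightarrow> real" where
  "app n a x r = (\<Sum>c<n. a r c * x c)"

lemma app_add: "app n a (\<lambda>i. x i + y i) = (\<lambda>r. app n a x r + app n a y r)"
  by (simp add: fun_eq_iff app_def algebra_simps sum.distrib)

lemma app_scale: "app n a (\<lambda>i. c * x i) = (\<lambda>r. c * app n a x r)"
  by (simp add: fun_eq_iff app_def sum_distrib_left algebra_simps)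

lemma app_cong: "(\<And>i. i < n \<Longrightarrow> x i = y i) \<Longrightarrow> app n a x = app n a y"
  by (simp add: fun_eq_iff app_def)

lemma ip_app_symmetric:
  assumes "\<And>i j. i < n \<Longrightarrow> j < n \<Longrightarrow> a i j = a j i"
  shows "ip {..<n} y (app n a x) = ip {..<n} (app n a y) x"
proof -
  have "ip {..<n} y (app n a x) = (\<Sum>i<n. \<Sum>j<n. y i * a i j * x j)"
    by (simp add: ip_def app_def sum_distrib_left mult.assoc)
  also have "\<dots> = (\<Sum>j<n. \<Sum>i<n. y i * a j i * x j)"
    using assms by (subst sum.swap) (intro sum.cong, auto)
  also have "\<dots> = ip {..<n} (app n a y) x"
    by (simp add: ip_def app_def sum_distrib_left sum_distrib_right mult_ac)
  finally show ?thesis .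
qed

text \<open>The first-order condition at a minimum: near t = 0 the linear term dominates. The test
  point t = -b/(c+1) has the shift by 1 to cover c = 0.\<close>

lemma quadratic_nonneg_linear_zero:
  fixes b c :: real
  assumes "\<And>t. 0 \<le> 2 * t * b + t\<^sup>2 * c" and "0 \<le> c"
  shows "b = 0"
proof (rule ccontr)
  assume "b \<noteq> 0"
  have "0 \<le> 2 * (- b / (c + 1)) * b + (- b / (c + 1))\<^sup>2 * c" by (rule assms(1))
  also have "\<dots> = - (b\<^sup>2 * (c + 2)) / (c + 1)\<^sup>2"
  proof -
    have "c + 1 \<noteq> 0" using \<open>0 \<le> c\<close> by simp
    then show ?thesis by (simp add: divide_simps) (simp add: algebra_simps power2_eq_square)
  qed
  also have "\<dots> < 0"
    using \<open>b \<noteq> 0\<close> \<open>0 \<le> c\<close> by (simp add: divide_neg_pos mult_neg_pos)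
  finally show False by simp
qed

text \<open>The maximiser of the Rayleigh quotient on the orthogonal complement of the eigenvectors
  found so far is again an eigenvector.\<close>

lemma next_eigenvector:
  assumes sym: "\<And>i j. i < n \<Longrightarrow> j < n \<Longrightarrow> a i j = a j i"
    and on: "\<And>i j. i < k \<Longrightarrow> j < k \<Longrightarrow> ip {..<n} (w i) (w j) = (if i = j then 1 else 0)"
    and eig: "\<And>i r. i < k \<Longrightarrow> r < n \<Longrightarrow> app n a (w i) r = lam i * w i r"
    and kn: "k < n"
  obtains x \<mu> where "ip {..<n} x x = 1" "\<And>i. i < k \<Longrightarrow> ip {..<n} (w i) x = 0"
    "\<And>r. r < n \<Longrightarrow> app n a x r = \<mu> * x r"
proof -
  define B where "B = {x :: nat \<Rightarrow> real. (\<forall>i<n. \<bar>x i\<bar> \<le> 1) \<and> (\<forall>i\<ge>n. x i = 0)}"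
  define W where "W = {x. \<forall>i<k. ip {..<n} (w i) x = 0}"
  \<comment> \<open>Unit vectors orthogonal to the eigenvectors found so far. Intersecting with
    \<open>B\<close> fixes the irrelevant coordinates and makes the set compact.\<close>
  define S where "S = B \<inter> (W \<inter> {x. ip {..<n} x x = 1})"
  define q where "q = (\<lambda>x. ip {..<n} x (app n a x))"
  have selfadj: "ip {..<n} y (app n a x) = ip {..<n} (app n a y) x" for x y
    by (rule ip_app_symmetric) (rule sym)
  have cont: "continuous_on UNIV (\<lambda>x::nat \<Rightarrow> real. ip {..<n} (u x) (v x))"
    if "\<And>i. continuous_on UNIV (\<lambda>x. u x i)" "\<And>i. continuous_on UNIV (\<lambda>x. v x i)" for u v
    unfolding ip_def by (intro continuous_intros that)
  have contapp: "continuous_on UNIV (\<lambda>x. app n a x i)" for i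
    unfolding app_def by (intro continuous_intros continuous_on_product_coordinates)
  have "closed (W \<inter> {x. ip {..<n} x x = 1})"
    unfolding W_def
    by (intro closed_Int closed_Collect_all closed_Collect_imp closed_Collect_eq cont
        continuous_on_const continuous_on_product_coordinates open_Collect_const)
  then have "compact S" unfolding S_def B_def by (intro compact_Int_closed compact_box)
  have normalise: "\<exists>y\<in>S. \<forall>i<n. x i = sqrt (ip {..<n} x x) * y i" if "x \<in> W" "ip {..<n} x x \<noteq> 0" for x
  proof -
    define s where "s = sqrt (ip {..<n} x x)"
    have s: "s > 0" "s\<^sup>2 = ip {..<n} x x"
      using that(2) ip_nonneg[of "{..<n}" x] by (auto simp: s_def less_le)
    define y where "y = (\<lambda>i. if i < n then (1 / s) * x i else 0)"
    have ipy: "ip {..<n} u y = (1 / s) * ip {..<n} u x" for u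
      unfolding ip_scale_right[symmetric] by (rule ip_cong) (auto simp: y_def)
    have "ip {..<n} y y = (1 / s) * ((1 / s) * ip {..<n} x x)"
      unfolding ipy by (subst ip_commute) (simp only: ipy)
    then have n1: "ip {..<n} y y = 1" using s by (simp flip: s(2) add: power2_eq_square)
    have "\<bar>y i\<bar> \<le> 1" if "i < n" for i
    proof -
      have "(y i)\<^sup>2 \<le> ip {..<n} y y"
        unfolding ip_def power2_eq_square using that by (intro member_le_sum) auto
      then show ?thesis using n1 by (simp add: abs_square_le_1)
    qed
    then have "y \<in> S" using n1 \<open>x \<in> W\<close> by (auto simp: S_def B_def W_def ipy) (simp add: y_def)
    moreover have "\<forall>i<n. x i = s * y i" using s by (simp add: y_def)
    ultimately show ?thesis unfolding s_def by blast
  qed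
  \<comment> \<open>The squared residuals of the unit vectors sum to n - k > 0, so one of them is
    positive; normalising that residual shows that \<open>S\<close> is nonempty.\<close>
  obtain j where j: "j < n" "1 - (\<Sum>i<k. (w i j)\<^sup>2) > 0"
  proof -
    have "\<not> (\<forall>j\<in>{..<n}. 1 - (\<Sum>i<k. (w i j)\<^sup>2) \<le> 0)"
    proof
      assume "\<forall>j\<in>{..<n}. 1 - (\<Sum>i<k. (w i j)\<^sup>2) \<le> 0"
      then have "(\<Sum>j<n. 1 - (\<Sum>i<k. (w i j)\<^sup>2)) \<le> 0" by (intro sum_nonpos) auto
      then show False using sum_residual_norms[of k n w, OF on] kn by simp
    qed
    then show ?thesis using that by (auto simp: not_le)
  qed
  have "S \<noteq> {}"
    using normalise[of "\<lambda>r. (if r = j then 1 else 0) - (\<Sum>i<k. w i j * w i r)"] j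
      residual_norm[of k n w j, OF on j(1)] by (auto simp: W_def)
  moreover have "continuous_on S q"
    unfolding q_def
    by (rule continuous_on_subset[OF cont]) (auto intro: contapp)
  ultimately obtain x where x: "x \<in> S" and max: "\<And>y. y \<in> S \<Longrightarrow> q y \<le> q x"
    using continuous_attains_sup[OF \<open>compact S\<close>] by blast
  define \<mu> where "\<mu> = q x"
  have x1: "ip {..<n} x x = 1" and xW: "x \<in> W" using x by (auto simp: S_def)
  \<comment> \<open>Both sides are homogeneous of degree 2, so the maximum over the unit sphere
    bounds \<open>q\<close> on all of \<open>W\<close>.\<close>
  have max': "q y \<le> \<mu> * ip {..<n} y y" if yW: "y \<in> W" for y
  proof (cases "ip {..<n} y y = 0")
    case True
    then have "\<forall>i<n. y i = 0" by (simp add: ip_self_eq_0)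
    then have "q y = 0" by (simp add: q_def ip_def)
    then show ?thesis using True by simp
  next
    case False
    then obtain z where z: "z \<in> S" "\<forall>i<n. y i = sqrt (ip {..<n} y y) * z i"
      using normalise[OF yW] by blast
    define s where "s = sqrt (ip {..<n} y y)"
    have y: "\<And>i. i < n \<Longrightarrow> y i = s * z i" using z by (simp add: s_def)
    have "q y = ip {..<n} (\<lambda>i. s * z i) (app n a (\<lambda>i. s * z i))"
      unfolding q_def using app_cong[of n y "\<lambda>i. s * z i" a] y by (auto intro: ip_cong)
    also have "\<dots> = s\<^sup>2 * q z" by (simp add: app_scale ip_linear q_def power2_eq_square)
    also have "\<dots> \<le> s\<^sup>2 * \<mu>" unfolding \<mu>_def using max z(1) by (intro mult_left_mono) auto
    finally show ?thesis by (simp add: s_def ip_nonneg mult.commute)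
  qed
  \<comment> \<open>Moving from \<open>x\<close> to x + t y stays in \<open>W\<close>, so the
    quadratic in t obtained from \<open>max'\<close> is nonnegative and its linear coefficient must
    vanish.\<close>
  have crit: "ip {..<n} y (\<lambda>r. \<mu> * x r - app n a x r) = 0" if yW: "y \<in> W" for y
  proof -
    have xAy: "ip {..<n} x (app n a y) = ip {..<n} y (app n a x)"
      by (subst selfadj) (rule ip_commute)
    have "0 \<le> 2 * t * ip {..<n} y (\<lambda>r. \<mu> * x r - app n a x r) + t\<^sup>2 * (\<mu> * ip {..<n} y y - q y)" for t
    proof -
      have "(\<lambda>i. x i + t * y i) \<in> W" using xW yW by (simp add: W_def ip_linear)
      from max'[OF this] have
        "q (\<lambda>i. x i + t * y i) \<le> \<mu> * ip {..<n} (\<lambda>i. x i + t * y i) (\<lambda>i. x i + t * y i)" .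
      moreover have "q (\<lambda>i. x i + t * y i) = \<mu> + 2 * t * ip {..<n} y (app n a x) + t\<^sup>2 * q y"
        unfolding q_def app_add app_scale ip_linear \<mu>_def
        by (simp add: xAy algebra_simps power2_eq_square)
      moreover have "ip {..<n} (\<lambda>i. x i + t * y i) (\<lambda>i. x i + t * y i)
          = 1 + 2 * t * ip {..<n} y x + t\<^sup>2 * ip {..<n} y y"
        unfolding ip_linear x1 by (simp add: ip_commute[of _ x y] algebra_simps power2_eq_square)
      ultimately have "\<mu> + 2 * t * ip {..<n} y (app n a x) + t\<^sup>2 * q y
          \<le> \<mu> * (1 + 2 * t * ip {..<n} y x + t\<^sup>2 * ip {..<n} y y)" by simp
      then show ?thesis unfolding ip_linear by (simp add: algebra_simps)
    qed
    then show ?thesis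
      by (rule quadratic_nonneg_linear_zero) (use max'[OF yW] in simp)
  qed
  \<comment> \<open>\<open>W\<close> is invariant because the operator is self-adjoint and the
    \<open>w i\<close> are eigenvectors. The vector \<mu> x - a x therefore lies in
    \<open>W\<close>, and by \<open>crit\<close> it is orthogonal to itself, hence zero.\<close>
  have "(\<lambda>r. \<mu> * x r - app n a x r) \<in> W"
  proof -
    have "ip {..<n} (w i) (app n a x) = 0" if "i < k" for i
    proof -
      have "ip {..<n} (w i) (app n a x) = ip {..<n} (\<lambda>r. lam i * w i r) x"
        unfolding selfadj by (rule ip_cong) (auto simp: eig that)
      then show ?thesis using xW that by (simp add: ip_linear W_def)
    qed
    then show ?thesis using xW by (simp add: W_def ip_linear)
  qed
  from crit[OF this] have "\<forall>r<n. \<mu> * x r - app n a x r = 0"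
    by (simp add: ip_self_eq_0)
  then show ?thesis using that[of x \<mu>] x1 xW by (auto simp: W_def)
qed

theorem symmetric_spectral:
  assumes sym: "\<And>i j. i < n \<Longrightarrow> j < n \<Longrightarrow> a i j = a j i"
  obtains w lam where
    "\<And>i j. i < n \<Longrightarrow> j < n \<Longrightarrow> ip {..<n} (w i) (w j) = (if i = j then 1 else 0)"
    "\<And>i r. i < n \<Longrightarrow> r < n \<Longrightarrow> app n a (w i) r = lam i * w i r"
proof -
  \<comment> \<open>Induction on the number of eigenvectors already found;
    \<open>next_eigenvector\<close> supplies one more as long as k < n.\<close>
  have "k \<le> n \<Longrightarrow> \<exists>w lam. (\<forall>i<k. \<forall>j<k. ip {..<n} (w i) (w j) = (if i = j then 1 else 0)) \<and>
      (\<forall>i<k. \<forall>r<n. app n a (w i) r = lam i * w i r)" for k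
  proof (induction k)
    case 0
    then show ?case by simp
  next
    case (Suc k)
    then obtain w lam where
      on: "\<And>i j. i < k \<Longrightarrow> j < k \<Longrightarrow> ip {..<n} (w i) (w j) = (if i = j then 1 else 0)" and
      eig: "\<And>i r. i < k \<Longrightarrow> r < n \<Longrightarrow> app n a (w i) r = lam i * w i r" by (metis Suc_leD)
    have "k < n" using Suc.prems by simp
    obtain x \<mu> where x: "ip {..<n} x x = 1" "\<And>i. i < k \<Longrightarrow> ip {..<n} (w i) x = 0"
      "\<And>r. r < n \<Longrightarrow> app n a x r = \<mu> * x r"
      by (rule next_eigenvector[of n a k w lam]) (auto simp: sym on eig \<open>k < n\<close>)
    have x': "ip {..<n} x (w i) = 0" if "i < k" for i
      using x(2)[OF that] by (simp add: ip_commute)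
    show ?case
      using on eig x x'
      by (intro exI[of _ "w(k := x)"] exI[of _ "lam(k := \<mu>)"])
        (auto simp: less_Suc_eq)
  qed
  from this[of n] show ?thesis using that by blast
qed

subsection \<open>Trace norm\<close>

text \<open>By completeness of the basis, a row is recovered from its products with the basis
  vectors.\<close>

lemma app_orthonormal_basis_eqI:
  assumes on: "\<And>i i'. i < n \<Longrightarrow> i' < n \<Longrightarrow> ip {..<n} (w i) (w i') = (if i = i' then 1 else 0)"
    and eq: "\<And>i. i < n \<Longrightarrow> app n a (w i) r = app n b (w i) r"
    and c: "c < n"
  shows "a r c = b r c"
proof -
  have expand: "a r c = (\<Sum>i<n. app n a (w i) r * w i c)" for a
  proof -
    have "(\<Sum>i<n. app n a (w i) r * w i c) = (\<Sum>i<n. \<Sum>c'<n. a r c' * (w i c * w i c'))"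
      by (simp add: app_def sum_distrib_left mult_ac)
    also have "\<dots> = (\<Sum>c'<n. a r c' * (\<Sum>i<n. w i c * w i c'))"
      by (subst sum.swap) (simp add: sum_distrib_left)
    also have "\<dots> = (\<Sum>c'<n. if c' = c then a r c' else 0)"
      using c by (intro sum.cong) (simp_all add: orthonormal_complete[of n w, OF on])
    finally show ?thesis using c by simp
  qed
  show ?thesis unfolding expand[of a] expand[of b] using eq by simp
qed

lemma app_mult_mat:
  assumes "X \<in> carrier_mat n n" "Y \<in> carrier_mat n n" "r < n"
  shows "app n (\<lambda>i j. (X * Y) $$ (i,j)) v r = app n (\<lambda>i j. X $$ (i,j)) (app n (\<lambda>i j. Y $$ (i,j)) v) r"
proof -
  have "app n (\<lambda>i j. (X * Y) $$ (i,j)) v r = (\<Sum>c<n. (\<Sum>k<n. X $$ (r,k) * Y $$ (k,c)) * v c)"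
    using assms by (auto simp: app_def scalar_prod_def atLeast0LessThan intro!: sum.cong)
  also have "\<dots> = (\<Sum>c<n. \<Sum>k<n. X $$ (r,k) * (Y $$ (k,c) * v c))"
    by (simp add: sum_distrib_right mult.assoc)
  also have "\<dots> = (\<Sum>k<n. X $$ (r,k) * (\<Sum>c<n. Y $$ (k,c) * v c))"
    by (subst sum.swap) (simp add: sum_distrib_left)
  finally show ?thesis by (simp add: app_def)
qed

lemma rpsd_app:
  assumes "rpsd X" "X \<in> carrier_mat n n"
  shows "0 \<le> ip {..<n} v (app n (\<lambda>i j. X $$ (i,j)) v)"
proof -
  have "ip {..<n} v (app n (\<lambda>i j. X $$ (i,j)) v) = (\<Sum>i<n. \<Sum>j<n. v i * X $$ (i,j) * v j)"
    by (simp add: ip_def app_def sum_distrib_left mult.assoc)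
  then show ?thesis using assms by (auto simp: rpsd_def)
qed

text \<open>This yields uniqueness of the square root. With y = B w - s w, the relation B^2 w = s^2
  w gives B y = - s y, so positivity of \<open>B\<close> forces y = 0 when s > 0. When s = 0, |y|^2
  = |B w|^2 = <w, B^2 w> = 0.\<close>

lemma rpsd_sqrt_eigenvector:
  assumes B: "rpsd B" "B \<in> carrier_mat n n" and s: "0 \<le> s"
    and eig: "\<And>r. r < n \<Longrightarrow> app n (\<lambda>i j. (B * B) $$ (i,j)) w r = s\<^sup>2 * w r"
    and r: "r < n"
  shows "app n (\<lambda>i j. B $$ (i,j)) w r = s * w r"
proof -
  define b where "b = (\<lambda>i j. B $$ (i,j))"
  define y where "y = (\<lambda>r. app n b w r + (- s) * w r)"
  have sym: "b i j = b j i" if "i < n" "j < n" for i j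
  proof -
    have "transpose_mat B = B" using B by (simp add: rpsd_def)
    then have "transpose_mat B $$ (i,j) = B $$ (i,j)" by simp
    then show ?thesis using that B(2) by (simp add: b_def)
  qed
  have bb: "app n b (app n b w) r = s\<^sup>2 * w r" if "r < n" for r
    using eig[OF that] app_mult_mat[OF B(2) B(2) that] by (simp add: b_def)
  have "app n b y r = - s * y r" if "r < n" for r
    unfolding y_def app_add app_scale using bb[OF that] by (simp add: algebra_simps power2_eq_square)
  then have "ip {..<n} y (app n b y) = - s * ip {..<n} y y"
    by (subst ip_scale_right[symmetric]) (rule ip_cong, auto)
  then have neg: "0 \<le> - s * ip {..<n} y y"
    using rpsd_app[OF B, of y] by (simp add: b_def)
  have "ip {..<n} y y = 0"
  proof (cases "s = 0")
    case True
    have "ip {..<n} y y = ip {..<n} (app n b w) (app n b w)" by (simp add: y_def True)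
    also have "\<dots> = ip {..<n} w (app n b (app n b w))"
      by (rule ip_app_symmetric[symmetric]) (rule sym)
    also have "\<dots> = 0" unfolding ip_def using bb True by simp
    finally show ?thesis .
  next
    case False
    then have "ip {..<n} y y \<le> 0" using neg s by (simp add: mult_le_0_iff)
    then show ?thesis using ip_nonneg[of "{..<n}" y] by linarith
  qed
  then have "y r = 0" using r by (simp add: ip_self_eq_0)
  then show ?thesis by (simp add: y_def b_def)
qed

text \<open>\<open>psd_sqrt\<close> is a definite description, so existence and uniqueness of the
  root are both established here, the former from the spectral formula and the latter from
  \<open>rpsd_sqrt_eigenvector\<close>.\<close>

lemma rtrace_psd_sqrt:
  assumes A: "A \<in> carrier_mat n n"
    and on: "\<And>i i'. i < n \<Longrightarrow> i' < n \<Longrightarrow> ip {..<n} (w i) (w i') = (if i = i' then 1 else 0)"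
    and s: "\<And>i. i < n \<Longrightarrow> 0 \<le> s i"
    and eig: "\<And>i r. i < n \<Longrightarrow> r < n \<Longrightarrow> app n (\<lambda>i j. A $$ (i,j)) (w i) r = (s i)\<^sup>2 * w i r"
  shows "rtrace (psd_sqrt A) = (\<Sum>i<n. s i)"
proof -
  \<comment> \<open>The spectral formula: the sum of s_i times the rank-one projections onto the
    eigenvectors.\<close>
  define b where "b = (\<lambda>r c. \<Sum>i<n. s i * (w i r * w i c))"
  define B where "B = mat n n (\<lambda>(r,c). b r c)"
  have B: "B \<in> carrier_mat n n" by (simp add: B_def)
  have appb: "app n b v r = (\<Sum>i<n. s i * ip {..<n} (w i) v * w i r)" for v r
    unfolding app_def b_def ip_def sum_distrib_right sum_distrib_left
    by (subst sum.swap) (simp add: mult_ac)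
  have appB: "app n (\<lambda>i j. B $$ (i,j)) v r = app n b v r" if "r < n" for v r
    using that by (simp add: app_def B_def)
  have eigB: "app n (\<lambda>i j. B $$ (i,j)) (w i) r = s i * w i r" if "i < n" "r < n" for i r
  proof -
    have "app n b (w i) r = (\<Sum>j<n. if j = i then s i * w i r else 0)"
      unfolding appb using on that by (intro sum.cong) auto
    then show ?thesis using that by (simp add: appB)
  qed
  have "rpsd B"
  proof -
    have "transpose_mat B = B"
      by (rule eq_matI) (auto simp: B_def b_def mult.commute)
    moreover have "0 \<le> (\<Sum>i<n. \<Sum>j<n. v i * B $$ (i,j) * v j)" for v
    proof -
      have "(\<Sum>i<n. \<Sum>j<n. v i * B $$ (i,j) * v j) = ip {..<n} v (app n b v)"
        by (simp add: ip_def app_def B_def sum_distrib_left mult.assoc)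
      also have "\<dots> = (\<Sum>i<n. s i * ip {..<n} (w i) v * ip {..<n} v (w i))"
        unfolding appb ip_sum_right ip_scale_right ..
      also have "\<dots> = (\<Sum>i<n. s i * (ip {..<n} (w i) v)\<^sup>2)"
        by (simp add: ip_commute[of _ v] power2_eq_square mult.assoc)
      also have "\<dots> \<ge> 0" using s by (intro sum_nonneg) simp
      finally show ?thesis .
    qed
    ultimately show ?thesis using B by (simp add: rpsd_def)
  qed
  moreover have "B * B = A"
  proof (rule eq_matI)
    fix r c assume "r < dim_row A" "c < dim_col A"
    then have rc: "r < n" "c < n" using A by auto
    have "app n (\<lambda>i j. (B * B) $$ (i,j)) (w i) r = app n (\<lambda>i j. A $$ (i,j)) (w i) r" if "i < n" for i
    proof -
      have "app n (\<lambda>i j. (B * B) $$ (i,j)) (w i) r = app n (\<lambda>i j. B $$ (i,j)) (\<lambda>r. s i * w i r) r"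
        unfolding app_mult_mat[OF B B rc(1)] using eigB[OF that]
        by (intro fun_cong[OF app_cong])
      then show ?thesis using that rc by (simp add: app_scale eigB eig power2_eq_square)
    qed
    from app_orthonormal_basis_eqI[of n w, OF on this rc(2)]
    show "(B * B) $$ (r,c) = A $$ (r,c)" by blast
  qed (use A B in auto)
  \<comment> \<open>Any positive semidefinite root acts on each \<open>w i\<close> as multiplication
    by \<open>s i\<close>, exactly as \<open>B\<close> does, and a matrix is determined by its
    action on the basis.\<close>
  moreover have "X = B" if X: "rpsd X" "X * X = A" for X
  proof (rule eq_matI)
    have Xn: "X \<in> carrier_mat n n"
    proof -
      have "dim_row X = n" using X(2) A by (metis carrier_matD(1) index_mult_mat(2))
      then show ?thesis using X(1) by (simp add: rpsd_def)
    qed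
    fix r c assume "r < dim_row B" "c < dim_col B"
    then have rc: "r < n" "c < n" by (auto simp: B_def)
    have "app n (\<lambda>i j. X $$ (i,j)) (w i) r = app n (\<lambda>i j. B $$ (i,j)) (w i) r" if "i < n" for i
      using rpsd_sqrt_eigenvector[OF X(1) Xn s[OF that], of "w i" r] eig that X(2) rc eigB by simp
    from app_orthonormal_basis_eqI[of n w, OF on this rc(2)]
    show "X $$ (r,c) = B $$ (r,c)" by blast
  next
    have "dim_row X = n" using X(2) A by (metis carrier_matD(1) index_mult_mat(2))
    then show "dim_row X = dim_row B" "dim_col X = dim_col B"
      using X(1) B by (auto simp: rpsd_def)
  qed
  ultimately have "psd_sqrt A = B" unfolding psd_sqrt_def by (intro the_equality conjI) blast+
  then have "rtrace (psd_sqrt A) = (\<Sum>r<n. \<Sum>i<n. s i * (w i r * w i r))"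
    by (simp add: rtrace_def B_def b_def)
  also have "\<dots> = (\<Sum>i<n. s i * ip {..<n} (w i) (w i))"
    unfolding ip_def sum_distrib_left by (rule sum.swap)
  finally show ?thesis using on by simp
qed

section \<open>The trace norm through singular values\<close>

lemma ip_app_gram:
  assumes "\<And>i j. i < n \<Longrightarrow> j < n \<Longrightarrow> a i j = (\<Sum>r<m. g r i * g r j)"
  shows "ip {..<n} x (app n a y) = ip {..<m} (app n g x) (app n g y)"
proof -
  have "ip {..<n} x (app n a y) = (\<Sum>i<n. \<Sum>j<n. \<Sum>r<m. (g r i * x i) * (g r j * y j))"
    using assms by (simp add: ip_def app_def sum_distrib_left sum_distrib_right mult_ac)
  also have "\<dots> = (\<Sum>i<n. \<Sum>r<m. \<Sum>j<n. (g r i * x i) * (g r j * y j))"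
    by (intro sum.cong refl sum.swap)
  also have "\<dots> = (\<Sum>r<m. \<Sum>i<n. \<Sum>j<n. (g r i * x i) * (g r j * y j))"
    by (rule sum.swap)
  finally show ?thesis by (simp add: ip_def app_def sum_product)
qed

text \<open>With right singular vectors w_i and left singular vectors z_i, each singular value is
  <z_i, G w_i>, which splits as the sum over t of p_t <z_i,u_t> <w_i,v_t>. Summing over i first
  leaves, for each t, a scalar product controlled by Cauchy-Schwarz and two Bessel
  inequalities.\<close>

lemma trace_norm_convex_rank_one_le:
  assumes G: "G \<in> carrier_mat m n"
    and Gsum: "\<And>r c. r < m \<Longrightarrow> c < n \<Longrightarrow> G $$ (r,c) = (\<Sum>t<q. p t * (u t r * v t c))"
    and p: "\<And>t. t < q \<Longrightarrow> 0 \<le> p t" "(\<Sum>t<q. p t) = 1"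
    and U: "\<And>t. t < q \<Longrightarrow> ip {..<m} (u t) (u t) \<le> U"
    and V: "\<And>t. t < q \<Longrightarrow> ip {..<n} (v t) (v t) \<le> V"
  shows "trace_norm G \<le> sqrt (U * V)"
proof -
  define g where "g = (\<lambda>r c. G $$ (r,c))"
  define A where "A = transpose_mat G * G"
  define a where "a = (\<lambda>i j. A $$ (i,j))"
  have A: "A \<in> carrier_mat n n" using G by (simp add: A_def)
  have a: "a i j = (\<Sum>r<m. g r i * g r j)" if "i < n" "j < n" for i j
    using that G by (simp add: a_def A_def g_def scalar_prod_def atLeast0LessThan)
  have gram: "ip {..<n} x (app n a y) = ip {..<m} (app n g x) (app n g y)" for x y
    by (rule ip_app_gram) (rule a)
  obtain w lam where
    on: "\<And>i j. i < n \<Longrightarrow> j < n \<Longrightarrow> ip {..<n} (w i) (w j) = (if i = j then 1 else 0)" and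
    eig: "\<And>i r. i < n \<Longrightarrow> r < n \<Longrightarrow> app n a (w i) r = lam i * w i r"
    by (rule symmetric_spectral[of n a]) (auto simp: a mult.commute)
  \<comment> \<open>The images of the eigenvectors of G^T G are mutually orthogonal with squared
    norms \<open>lam i\<close>; in particular the eigenvalues are nonnegative and have real square
    roots.\<close>
  have gw: "ip {..<m} (app n g (w i)) (app n g (w j)) = (if i = j then lam i else 0)"
    if "i < n" "j < n" for i j
  proof -
    have "ip {..<m} (app n g (w i)) (app n g (w j)) = ip {..<n} (w i) (\<lambda>r. lam j * w j r)"
      unfolding gram[symmetric] by (rule ip_cong) (auto simp: eig that)
    then show ?thesis using on that by (simp add: ip_scale_right)
  qed
  define s where "s = (\<lambda>i. sqrt (lam i))"
  have lam: "0 \<le> lam i" if "i < n" for i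
    using gw[OF that that] ip_nonneg[of "{..<m}" "app n g (w i)"] by simp
  have s2: "(s i)\<^sup>2 = lam i" "0 \<le> s i" if "i < n" for i using lam[OF that] by (auto simp: s_def)
  have tn: "trace_norm G = (\<Sum>i<n. s i)"
    unfolding trace_norm_def A_def[symmetric]
    by (rule rtrace_psd_sqrt[OF A, where w = w]) (use on s2 eig in \<open>auto simp: a_def\<close>)
  \<comment> \<open>The left singular vectors; those belonging to the singular value 0 vanish since 1/0 = 0.\<close>
  define z where "z = (\<lambda>i r. (1 / s i) * app n g (w i) r)"
  have zz: "ip {..<m} (z i) (z j) = (if i = j \<and> s i \<noteq> 0 then 1 else 0)" if "i < n" "j < n" for i j
    unfolding z_def ip_linear gw[OF that] using that by (auto simp flip: s2(1) simp: power2_eq_square)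
  have s_eq: "s i = (\<Sum>t<q. p t * (ip {..<m} (z i) (u t) * ip {..<n} (w i) (v t)))" if "i < n" for i
  proof -
    have "s i = ip {..<m} (z i) (app n g (w i))"
      unfolding z_def ip_linear gw[OF that that] using that
      by (auto simp flip: s2(1) simp: power2_eq_square)
    also have "\<dots> = ip {..<m} (z i) (\<lambda>r. \<Sum>t<q. (p t * ip {..<n} (w i) (v t)) * u t r)"
    proof (rule ip_cong[OF refl])
      fix r assume "r \<in> {..<m}"
      then have "app n g (w i) r = (\<Sum>c<n. \<Sum>t<q. p t * (u t r * v t c) * w i c)"
        by (simp add: app_def g_def Gsum sum_distrib_right)
      also have "\<dots> = (\<Sum>t<q. (p t * ip {..<n} (w i) (v t)) * u t r)"
        unfolding ip_def sum_distrib_left sum_distrib_right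
        by (subst sum.swap) (simp add: mult_ac)
      finally show "app n g (w i) r = (\<Sum>t<q. (p t * ip {..<n} (w i) (v t)) * u t r)" .
    qed
    also have "\<dots> = (\<Sum>t<q. p t * (ip {..<m} (z i) (u t) * ip {..<n} (w i) (v t)))"
      unfolding ip_sum_right ip_scale_right by (simp add: mult_ac)
    finally show ?thesis .
  qed
  have bound: "(\<Sum>i<n. ip {..<m} (z i) (u t) * ip {..<n} (w i) (v t)) \<le> sqrt (U * V)" if "t < q" for t
  proof -
    have "(\<Sum>i<n. ip {..<m} (z i) (u t) * ip {..<n} (w i) (v t))\<^sup>2
        \<le> (\<Sum>i<n. (ip {..<m} (z i) (u t))\<^sup>2) * (\<Sum>i<n. (ip {..<n} (w i) (v t))\<^sup>2)"
      by (rule Cauchy_Schwarz_ineq_sum)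
    also have "\<dots> \<le> ip {..<m} (u t) (u t) * ip {..<n} (v t) (v t)"
      by (intro mult_mono bessel) (auto simp: zz on ip_nonneg sum_nonneg)
    also have "\<dots> \<le> U * V"
      using U[OF that] V[OF that] ip_nonneg[of "{..<m}" "u t"] ip_nonneg[of "{..<n}" "v t"]
      by (intro mult_mono) auto
    finally show ?thesis by (rule real_le_rsqrt)
  qed
  have "(\<Sum>i<n. s i) = (\<Sum>t<q. p t * (\<Sum>i<n. ip {..<m} (z i) (u t) * ip {..<n} (w i) (v t)))"
    unfolding sum_distrib_left by (subst sum.swap) (simp add: s_eq)
  \<comment> \<open>The bound does not depend on t, so averaging with the weights \<open>p t\<close>
    keeps it.\<close>
  also have "\<dots> \<le> (\<Sum>t<q. p t * sqrt (U * V))"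
    using p(1) bound by (intro sum_mono mult_left_mono) auto
  also have "\<dots> = sqrt (U * V)" using p(2) by (simp flip: sum_distrib_right)
  finally show ?thesis by (simp add: tn)
qed

subsection \<open>Measurement statistics of a state\<close>

lemma sum_lessThan_mult:
  fixes f :: "nat \<Rightarrow> 'a::comm_monoid_add"
  shows "(\<Sum>r<N * M. f r) = (\<Sum>a<N. \<Sum>k<M. f (a * M + k))"
proof -
  have "sum f {a * M..<a * M + M} = (\<Sum>k<M. f (a * M + k))" for a
    using sum.shift_bounds_nat_ivl[of f 0 "a * M" M] by (simp add: atLeast0LessThan add.commute)
  then show ?thesis by (simp flip: sum.nat_group)
qed

section \<open>Hermitian matrices as real vectors, and the purity bound\<close>

lemma ctrace_mult:
  assumes "A \<in> carrier_mat d d" "B \<in> carrier_mat d d"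
  shows "ctrace (A * B) = (\<Sum>i<d. \<Sum>j<d. A $$ (i,j) * B $$ (j,i))"
  using assms by (auto simp: ctrace_def scalar_prod_def atLeast0LessThan intro!: sum.cong)

lemma cpsd_carrier: "cpsd d A \<Longrightarrow> A \<in> carrier_mat d d"
  by (simp add: cpsd_def)

lemma cpsd_cnj:
  assumes "cpsd d A" "i < d" "j < d"
  shows "A $$ (j,i) = cnj (A $$ (i,j))"
proof -
  have "cadj A $$ (j,i) = A $$ (j,i)" using assms by (simp add: cpsd_def)
  then show ?thesis using assms cpsd_carrier[OF assms(1)] by (simp add: cadj_def)
qed

text \<open>Hermiticity makes the trace equal to its own conjugate. Realness of these local
  probabilities is what lets the real part of a product of traces factor.\<close>

lemma Im_ctrace_mult_cpsd:
  assumes "cpsd d A" "cpsd d B"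
  shows "Im (ctrace (A * B)) = 0"
proof -
  have "ctrace (A * B) = (\<Sum>i<d. \<Sum>j<d. A $$ (j,i) * B $$ (i,j))"
    using assms by (subst ctrace_mult[of _ d]) (auto simp: cpsd_carrier intro: sum.swap)
  also have "\<dots> = (\<Sum>i<d. \<Sum>j<d. cnj (A $$ (i,j) * B $$ (j,i)))"
    using assms cpsd_cnj by (intro sum.cong) (auto simp flip: cpsd_cnj)
  also have "\<dots> = cnj (ctrace (A * B))"
    using assms by (simp add: ctrace_mult[of _ d] cpsd_carrier)
  finally show ?thesis by (simp add: complex_eq_iff)
qed

lemma Im_cpsd_diag: "cpsd d A \<Longrightarrow> i < d \<Longrightarrow> Im (A $$ (i,i)) = 0"
  using cpsd_cnj[of d A i i] by (simp add: complex_eq_iff)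

definition hvec :: "complex mat \<Rightarrow> nat \<times> nat \<Rightarrow> real" where
  "hvec A = (\<lambda>(i,j). Re (A $$ (i,j)) + Im (A $$ (i,j)))"

text \<open>On Hermitian matrices the map \<^const>\<open>hvec\<close> is an isometry for the Hilbert-Schmidt inner product:
  real parts are symmetric and imaginary parts antisymmetric, so the mixed terms cancel.\<close>

lemma ip_hvec:
  assumes A: "cpsd d A" and B: "cpsd d B"
  shows "ip ({..<d} \<times> {..<d}) (hvec A) (hvec B) = Re (ctrace (A * B))"
proof -
  have mixed: "(\<Sum>i<d. \<Sum>j<d. Re (X $$ (i,j)) * Im (Y $$ (i,j))) = 0" if X: "cpsd d X" and Y: "cpsd d Y" for X Y
  proof -
    have "(\<Sum>i<d. \<Sum>j<d. Re (X $$ (i,j)) * Im (Y $$ (i,j))) = (\<Sum>i<d. \<Sum>j<d. Re (X $$ (j,i)) * Im (Y $$ (j,i)))"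
      by (rule sum.swap)
    also have "\<dots> = (\<Sum>i<d. \<Sum>j<d. - (Re (X $$ (i,j)) * Im (Y $$ (i,j))))"
    proof (intro sum.cong refl)
      fix i j assume "i \<in> {..<d}" "j \<in> {..<d}"
      then show "Re (X $$ (j,i)) * Im (Y $$ (j,i)) = - (Re (X $$ (i,j)) * Im (Y $$ (i,j)))"
        using cpsd_cnj[OF X, of i j] cpsd_cnj[OF Y, of i j] by simp
    qed
    finally show ?thesis by (simp add: sum_negf)
  qed
  have "Re (ctrace (A * B)) = (\<Sum>i<d. \<Sum>j<d. Re (A $$ (i,j)) * Re (B $$ (i,j)) + Im (A $$ (i,j)) * Im (B $$ (i,j)))"
    unfolding ctrace_mult[OF cpsd_carrier[OF A] cpsd_carrier[OF B]] Re_sum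
  proof (intro sum.cong refl)
    fix i j assume "i \<in> {..<d}" "j \<in> {..<d}"
    then show "Re (A $$ (i,j) * B $$ (j,i)) = Re (A $$ (i,j)) * Re (B $$ (i,j)) + Im (A $$ (i,j)) * Im (B $$ (i,j))"
      using cpsd_cnj[OF B, of i j] by simp
  qed
  moreover have "ip ({..<d} \<times> {..<d}) (hvec A) (hvec B)
      = (\<Sum>i<d. \<Sum>j<d. Re (A $$ (i,j)) * Re (B $$ (i,j)) + Im (A $$ (i,j)) * Im (B $$ (i,j)))
        + (\<Sum>i<d. \<Sum>j<d. Re (A $$ (i,j)) * Im (B $$ (i,j))) + (\<Sum>i<d. \<Sum>j<d. Re (B $$ (i,j)) * Im (A $$ (i,j)))"
    unfolding ip_def hvec_def sum.cartesian_product
    by (simp add: algebra_simps flip: sum.distrib)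
  ultimately show ?thesis using mixed[OF A B] mixed[OF B A] by simp
qed

text \<open>The image of the identity matrix under \<open>hvec\<close>; pairing with it yields the
  trace.\<close>

definition diag_ind :: "nat \<times> nat \<Rightarrow> real" where
  "diag_ind = (\<lambda>(i,j). if i = j then 1 else 0)"

lemma ip_diag_ind:
  "ip ({..<d} \<times> {..<d}) diag_ind f = (\<Sum>i<d. f (i,i))"
proof -
  have "ip ({..<d} \<times> {..<d}) diag_ind f = (\<Sum>i<d. \<Sum>j<d. if i = j then f (i,j) else 0)"
    unfolding ip_def diag_ind_def sum.cartesian_product by (intro sum.cong) auto
  then show ?thesis by simp
qed

lemma ip_diag_ind_hvec:
  assumes "cpsd d A"
  shows "ip ({..<d} \<times> {..<d}) diag_ind (hvec A) = Re (ctrace A)"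
  using Im_cpsd_diag[OF assms] cpsd_carrier[OF assms] by (simp add: ip_diag_ind hvec_def ctrace_def)

text \<open>Positivity tested on a vector supported on two coordinates, that is, on a 2 by 2
  principal submatrix.\<close>

lemma cpsd_quadratic_form:
  assumes A: "cpsd d A" and ij: "i < d" "j < d" "i \<noteq> j"
  shows "0 \<le> Re (cnj x * A $$ (i,i) * x + cnj x * A $$ (i,j) * y + cnj y * A $$ (j,i) * x + cnj y * A $$ (j,j) * y)"
proof -
  define v where "v = (\<lambda>k. if k = i then x else if k = j then y else 0)"
  have two: "(\<Sum>k<d. f k) = f i + f j" if "\<And>k. k \<noteq> i \<Longrightarrow> k \<noteq> j \<Longrightarrow> f k = 0" for f :: "nat \<Rightarrow> complex"
  proof -
    have "(\<Sum>k<d. f k) = sum f {i,j}" using ij that by (intro sum.mono_neutral_right) auto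
    then show ?thesis using ij by simp
  qed
  have "0 \<le> Re (\<Sum>k<d. \<Sum>l<d. cnj (v k) * A $$ (k,l) * v l)" using A by (simp add: cpsd_def)
  also have "(\<Sum>k<d. \<Sum>l<d. cnj (v k) * A $$ (k,l) * v l)
      = (\<Sum>l<d. cnj (v i) * A $$ (i,l) * v l) + (\<Sum>l<d. cnj (v j) * A $$ (j,l) * v l)"
    by (rule two) (simp add: v_def)
  also have "(\<Sum>l<d. cnj (v i) * A $$ (i,l) * v l) = cnj x * A $$ (i,i) * x + cnj x * A $$ (i,j) * y"
    using ij by (subst two) (auto simp: v_def)
  also have "(\<Sum>l<d. cnj (v j) * A $$ (j,l) * v l) = cnj y * A $$ (j,i) * x + cnj y * A $$ (j,j) * y"
    using ij by (subst two) (auto simp: v_def)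
  finally show ?thesis by (simp add: add.assoc)
qed

text \<open>Nonnegativity of the 2 by 2 principal minors. Testing with the vector (\<alpha>,
  conjugate of z), where z is the off-diagonal entry, gives a real quadratic in \<alpha>.\<close>

lemma cpsd_entry_bound:
  assumes A: "cpsd d A" and ij: "i < d" "j < d"
  shows "(cmod (A $$ (i,j)))\<^sup>2 \<le> Re (A $$ (i,i)) * Re (A $$ (j,j))"
proof (cases "i = j")
  case True
  then show ?thesis using Im_cpsd_diag[OF A ij(1)] by (simp add: cmod_def power2_eq_square)
next
  case False
  define z a b q where "z = A $$ (i,j)" "a = Re (A $$ (i,i))" "b = Re (A $$ (j,j))" "q = (cmod z)\<^sup>2"
  note d = this
  have Ai: "A $$ (i,i) = of_real a" and Aj: "A $$ (j,j) = of_real b" and Az: "A $$ (j,i) = cnj z"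
    using Im_cpsd_diag[OF A ij(1)] Im_cpsd_diag[OF A ij(2)] cpsd_cnj[OF A ij]
    by (auto simp: d complex_eq_iff)
  have q: "q = (Re z)\<^sup>2 + (Im z)\<^sup>2" by (simp add: d cmod_def)
  have form: "0 \<le> \<alpha>\<^sup>2 * a + 2 * \<alpha> * q + q * b" for \<alpha>
  proof -
    have "Re (cnj (of_real \<alpha>) * A $$ (i,i) * of_real \<alpha> + cnj (of_real \<alpha>) * A $$ (i,j) * cnj z
        + cnj (cnj z) * A $$ (j,i) * of_real \<alpha> + cnj (cnj z) * A $$ (j,j) * cnj z) = \<alpha>\<^sup>2 * a + 2 * \<alpha> * q + q * b"
      unfolding Ai Aj Az d(1)[symmetric] q by (simp add: algebra_simps power2_eq_square)
    then show ?thesis using cpsd_quadratic_form[OF A ij False, of "of_real \<alpha>" "cnj z"] by simp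
  qed
  have a0: "0 \<le> a" using cpsd_quadratic_form[OF A ij False, of 1 0] by (simp add: d)
  have b0: "0 \<le> b" using cpsd_quadratic_form[OF A ij False, of 0 1] by (simp add: d)
  have "q \<le> a * b"
  proof (cases "b = 0")
    case True
    have "q = 0"
      by (rule quadratic_nonneg_linear_zero[of q a]) (use form True a0 in \<open>auto simp: add.commute\<close>)
    then show ?thesis using True by simp
  next
    case False
    \<comment> \<open>The choice \<alpha> = -b makes the quadratic factor as b (a b - q).\<close>
    have "0 \<le> b * (a * b - q)" using form[of "- b"] by (simp add: algebra_simps power2_eq_square)
    then show ?thesis using False b0 by (simp add: zero_le_mult_iff)
  qed
  then show ?thesis by (simp add: d)
qed

text \<open>The purity is the sum of the squared moduli of the entries; by the minor bound this is
  at most the sum of all products of two diagonal entries, which is the squared trace.\<close>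

lemma density_purity_le_1:
  assumes "density d \<rho>"
  shows "Re (ctrace (\<rho> * \<rho>)) \<le> 1"
proof -
  have \<rho>: "cpsd d \<rho>" and tr: "ctrace \<rho> = 1" using assms by (auto simp: density_def)
  have "Re (ctrace (\<rho> * \<rho>)) = (\<Sum>i<d. \<Sum>j<d. (cmod (\<rho> $$ (i,j)))\<^sup>2)"
    unfolding ctrace_mult[OF cpsd_carrier[OF \<rho>] cpsd_carrier[OF \<rho>]] Re_sum
  proof (intro sum.cong refl)
    fix i j assume "i \<in> {..<d}" "j \<in> {..<d}"
    then show "Re (\<rho> $$ (i,j) * \<rho> $$ (j,i)) = (cmod (\<rho> $$ (i,j)))\<^sup>2"
      using cpsd_cnj[OF \<rho>, of i j] by (simp add: cmod_def power2_eq_square)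
  qed
  also have "\<dots> \<le> (\<Sum>i<d. \<Sum>j<d. Re (\<rho> $$ (i,i)) * Re (\<rho> $$ (j,j)))"
    by (intro sum_mono cpsd_entry_bound[OF \<rho>]) auto
  also have "\<dots> = (Re (ctrace \<rho>))\<^sup>2"
    using cpsd_carrier[OF \<rho>] by (simp add: ctrace_def power2_eq_square sum_product carrier_matD)
  finally show ?thesis by (simp add: tr)
qed

theorem povm_index_of_coincidence:
  assumes E: "IC_POVM d N M x E" and \<rho>: "density d \<rho>"
  shows "(\<Sum>r<N * M. (tauvec N M E \<rho> r)\<^sup>2)
    \<le> (real d - 1) * (real d ^ 2 + real M ^ 2 * x) / (real d * real M * (real M - 1))"
proof -
  have M: "M \<ge> 2" and x: "real d / real M ^ 2 < x" "x \<le> real d ^ 2 / real M ^ 2"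
    and psd: "\<And>a k. a < N \<Longrightarrow> k < M \<Longrightarrow> cpsd d (E a k)"
    and comp: "\<And>a i j. a < N \<Longrightarrow> i < d \<Longrightarrow> j < d \<Longrightarrow> (\<Sum>k<M. E a k $$ (i,j)) = (if i = j then 1 else 0)"
    and tr: "\<And>a k. a < N \<Longrightarrow> k < M \<Longrightarrow> ctrace (E a k) = complex_of_real (real d / real M)"
    and trsq: "\<And>a k. a < N \<Longrightarrow> k < M \<Longrightarrow> ctrace (E a k * E a k) = complex_of_real x"
    and trsame: "\<And>a k l. a < N \<Longrightarrow> k < M \<Longrightarrow> l < M \<Longrightarrow> l \<noteq> k \<Longrightarrow>
        ctrace (E a k * E a l) = complex_of_real ((real d - real M * x) / (real M * (real M - 1)))"
    and trdiff: "\<And>a b k l. a < N \<Longrightarrow> b < N \<Longrightarrow> k < M \<Longrightarrow> l < M \<Longrightarrow> b \<noteq> a \<Longrightarrow>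
        ctrace (E a k * E b l) = complex_of_real (real d / real M ^ 2)"
    and N: "N * (M - 1) = d^2 - 1"
    using E unfolding IC_POVM_def NM_POVM_def by auto
  have \<rho>p: "cpsd d \<rho>" and \<rho>tr: "ctrace \<rho> = 1" using \<rho> by (auto simp: density_def)
  \<comment> \<open>For d = 0 the two bounds on the parameter would read 0 < x and x \<le>
    0.\<close>
  have d: "d > 0" using x by (cases d) auto
  define I where "I = {..<d} \<times> {..<d}"
  \<comment> \<open>\<open>F\<close> and \<open>v\<close> represent the traceless parts of the
    effects and of the state.\<close>
  define F where "F = (\<lambda>(a,k) p. hvec (E a k) p - (1 / M) * diag_ind p)"
  define v where "v = (\<lambda>p. hvec \<rho> p - (1 / d) * diag_ind p)"
  define P where "P = (\<lambda>a k. Re (ctrace (E a k * \<rho>)))"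
  define T where "T = {..<N} \<times> {..<M}"
  \<comment> \<open>\<open>c\<close> is the squared norm of each \<open>F (a,k)\<close>, and
    \<open>K\<close> is the eigenvalue of the Gram matrix on coefficients that sum to zero for each
    a.\<close>
  define c where "c = x - d / M ^ 2"
  define K where "K = c * M / (M - 1)"
  have c: "c > 0" using x by (simp add: c_def)
  have K: "K \<ge> 0" using c M by (simp add: K_def)
  have dd: "ip I diag_ind diag_ind = d" by (simp add: I_def ip_diag_ind) (simp add: diag_ind_def)
  have dE: "ip I diag_ind (hvec (E a k)) = d / M" "ip I (hvec (E a k)) diag_ind = d / M" if "a < N" "k < M" for a k
    using tr[OF that] psd[OF that] by (simp_all add: I_def ip_diag_ind_hvec ip_commute[of _ _ diag_ind])
  have d\<rho>: "ip I diag_ind (hvec \<rho>) = 1" "ip I (hvec \<rho>) diag_ind = 1"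
    using \<rho>tr \<rho>p by (simp_all add: I_def ip_diag_ind_hvec ip_commute[of _ "hvec \<rho>" diag_ind])
  have Fv: "ip I (F (a,k)) v = P a k - 1 / M" if "a < N" "k < M" for a k
    unfolding F_def v_def prod.case ip_linear dE[OF that] d\<rho> dd
    using ip_hvec[OF psd[OF that] \<rho>p] d by (simp add: P_def I_def)
  have FF: "ip I (F (a,k)) (F (b,l)) = Re (ctrace (E a k * E b l)) - d / M ^ 2"
    if "a < N" "k < M" "b < N" "l < M" for a b k l
    unfolding F_def prod.case ip_linear dE[OF that(1,2)] dE[OF that(3,4)] dd
    using ip_hvec[OF psd[OF that(1,2)] psd[OF that(3,4)]] by (simp add: I_def power2_eq_square)
  have Psum: "(\<Sum>k<M. P a k) = 1" if a: "a < N" for a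
  proof -
    have "(\<Sum>k<M. ctrace (E a k * \<rho>)) = (\<Sum>k<M. \<Sum>i<d. \<Sum>j<d. E a k $$ (i,j) * \<rho> $$ (j,i))"
      using psd[OF a] \<rho>p by (intro sum.cong refl ctrace_mult) (auto simp: cpsd_carrier)
    also have "\<dots> = (\<Sum>i<d. \<Sum>k<M. \<Sum>j<d. E a k $$ (i,j) * \<rho> $$ (j,i))"
      by (rule sum.swap)
    also have "\<dots> = (\<Sum>i<d. \<Sum>j<d. \<Sum>k<M. E a k $$ (i,j) * \<rho> $$ (j,i))"
      by (intro sum.cong refl sum.swap)
    also have "\<dots> = (\<Sum>i<d. \<Sum>j<d. if i = j then \<rho> $$ (j,i) else 0)"
      using comp[OF a] by (intro sum.cong refl) (auto simp flip: sum_distrib_right)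
    also have "\<dots> = ctrace \<rho>"
      using cpsd_carrier[OF \<rho>p] by (simp add: ctrace_def carrier_matD)
    finally show ?thesis using \<rho>tr unfolding P_def Re_sum[symmetric] by simp
  qed
  define f where "f = (\<lambda>a k. P a k - 1 / M)"
  have fsum: "(\<Sum>k<M. f a k) = 0" if "a < N" for a
    using Psum[OF that] M by (simp add: f_def sum_subtractf)
  \<comment> \<open>The coefficients \<open>f\<close> form an eigenvector of the Gram matrix. Blocks
    with different first index are orthogonal; within a block the entries are c on and -c/(M-1) off
    the diagonal, and the constant part is annihilated by \<open>fsum\<close>. What remains is c +
    c/(M-1) = K.\<close>
  have row: "(\<Sum>b<N. \<Sum>l<M. f b l * ip I (F (a,k)) (F (b,l))) = K * f a k" if ak: "a < N" "k < M" for a k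
  proof -
    have off: "(real d - real M * x) / (real M * (real M - 1)) - d / M ^ 2 = - c / (M - 1)"
      using M by (simp add: c_def divide_simps) (simp add: algebra_simps power2_eq_square of_nat_diff)
    have "(\<Sum>b<N. \<Sum>l<M. f b l * ip I (F (a,k)) (F (b,l)))
        = (\<Sum>b<N. if b = a then (\<Sum>l<M. f a l * ip I (F (a,k)) (F (a,l))) else 0)"
      using ak by (intro sum.cong refl) (auto simp: FF trdiff intro!: sum.neutral)
    also have "\<dots> = (\<Sum>l<M. f a l * ip I (F (a,k)) (F (a,l)))" using ak by simp
    also have "\<dots> = (\<Sum>l<M. - c / (M - 1) * f a l + (if l = k then (c + c / (M - 1)) * f a k else 0))"
    proof (intro sum.cong refl)
      fix l assume "l \<in> {..<M}"
      then have l: "l < M" by simp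
      show "f a l * ip I (F (a,k)) (F (a,l)) = - c / (M - 1) * f a l + (if l = k then (c + c / (M - 1)) * f a k else 0)"
      proof (cases "l = k")
        case True
        then have "ip I (F (a,k)) (F (a,l)) = c" using ak by (simp add: FF trsq c_def)
        then show ?thesis using True by (simp add: distrib_right)
      next
        case False
        then have "ip I (F (a,k)) (F (a,l)) = - c / (M - 1)"
          using ak l off by (simp add: FF trsame)
        then show ?thesis using False by simp
      qed
    qed
    also have "\<dots> = (c + c / (M - 1)) * f a k"
      unfolding sum.distrib sum_distrib_left[symmetric] using ak fsum by simp
    also have "c + c / (M - 1) = K" using M by (simp add: K_def divide_simps) (simp add: algebra_simps of_nat_diff)
    finally show ?thesis .
  qed
  have sumT: "(\<Sum>t\<in>T. g t) = (\<Sum>a<N. \<Sum>k<M. g (a,k))" for g :: "nat \<times> nat \<Rightarrow> real"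
    by (simp add: T_def sum.cartesian_product)
  have "(\<Sum>s\<in>T. \<Sum>t\<in>T. ip I (F s) v * ip I (F t) v * ip I (F s) (F t))
      = (\<Sum>a<N. \<Sum>k<M. f a k * (\<Sum>b<N. \<Sum>l<M. f b l * ip I (F (a,k)) (F (b,l))))"
    unfolding sumT by (simp add: Fv f_def sum_distrib_left mult.assoc)
  also have "\<dots> = (\<Sum>a<N. \<Sum>k<M. K * (f a k)\<^sup>2)"
    by (intro sum.cong refl) (simp add: row power2_eq_square)
  also have "\<dots> = K * (\<Sum>t\<in>T. (ip I (F t) v)\<^sup>2)"
    unfolding sumT by (simp add: Fv f_def sum_distrib_left)
  finally have "(\<Sum>t\<in>T. (ip I (F t) v)\<^sup>2) \<le> K * ip I v v"
    using frame_bound[OF K, of I F v T] by simp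
  also have "ip I v v = Re (ctrace (\<rho> * \<rho>)) - 1 / d"
    unfolding v_def ip_linear d\<rho> dd using ip_hvec[OF \<rho>p \<rho>p] d by (simp add: I_def)
  also have "K * \<dots> \<le> K * (1 - 1 / d)"
    using density_purity_le_1[OF \<rho>] K by (intro mult_left_mono) auto
  finally have fbound: "(\<Sum>a<N. \<Sum>k<M. (f a k)\<^sup>2) \<le> K * (1 - 1 / d)"
    unfolding sumT by (simp add: Fv f_def)
  have "(\<Sum>r<N * M. (tauvec N M E \<rho> r)\<^sup>2) = (\<Sum>a<N. \<Sum>k<M. (P a k)\<^sup>2)"
    unfolding sum_lessThan_mult by (simp add: tauvec_def P_def)
  \<comment> \<open>Restoring the mean 1/M of each distribution: the cross term vanishes by
    \<open>fsum\<close>, and M terms 1/M^2 remain.\<close>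
  also have "\<dots> = (\<Sum>a<N. (\<Sum>k<M. (f a k)\<^sup>2) + 1 / M)"
  proof (intro sum.cong refl)
    fix a assume "a \<in> {..<N}"
    then have a: "a < N" by simp
    have "(\<Sum>k<M. (P a k)\<^sup>2) = (\<Sum>k<M. (f a k)\<^sup>2 + 2 / M * f a k + 1 / M ^ 2)"
      by (intro sum.cong refl) (simp add: f_def power2_eq_square algebra_simps)
    also have "\<dots> = (\<Sum>k<M. (f a k)\<^sup>2) + 1 / M"
      unfolding sum.distrib sum_distrib_left[symmetric] fsum[OF a] using M by (simp add: power2_eq_square)
    finally show "(\<Sum>k<M. (P a k)\<^sup>2) = (\<Sum>k<M. (f a k)\<^sup>2) + 1 / M" .
  qed
  also have "\<dots> \<le> K * (1 - 1 / d) + N / M"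
    using fbound by (simp add: sum.distrib)
  also have "\<dots> = (real d - 1) * (real d ^ 2 + real M ^ 2 * x) / (real d * real M * (real M - 1))"
  proof -
    \<comment> \<open>Informational completeness fixes N. Its natural-number subtractions agree with
      real ones since M \<ge> 2 and d > 0.\<close>
    have "real N * (real M - 1) = real d ^ 2 - 1"
    proof -
      have "real (N * (M - 1)) = real (d^2 - 1)" using N by simp
      then show ?thesis using M d by (simp add: of_nat_diff)
    qed
    then have Nval: "real N = (real d ^ 2 - 1) / (real M - 1)" using M by (simp add: field_simps)
    show ?thesis
      unfolding K_def c_def Nval using M d
      by (simp add: of_nat_diff divide_simps) (simp add: algebra_simps power2_eq_square)
  qed
  finally show ?thesis .
qed

subsection \<open>Separable states\<close>

lemma lex_index_less:
  fixes i j m n :: nat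
  assumes "i < m" "j < n"
  shows "i * n + j < m * n"
proof -
  have "i * n + j < Suc i * n" using assms by simp
  also have "\<dots> \<le> m * n" using assms by (intro mult_le_mono1) simp
  finally show ?thesis .
qed

section \<open>Kronecker products and partial traces of separable states\<close>

lemma kron_index:
  assumes "A \<in> carrier_mat m m" "B \<in> carrier_mat n n" "i < m" "i' < m" "j < n" "j' < n"
  shows "kron A B $$ (i * n + j, i' * n + j') = A $$ (i,i') * B $$ (j,j')"
proof -
  have "i * n + j < m * n" "i' * n + j' < m * n"
    using assms by (auto intro: lex_index_less)
  then show ?thesis using assms by (simp add: kron_def)
qed

lemma kron_carrier:
  "A \<in> carrier_mat m m \<Longrightarrow> B \<in> carrier_mat n n \<Longrightarrow> kron A B \<in> carrier_mat (m * n) (m * n)"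
  by (simp add: kron_def)

lemma ctrace_kron_mult:
  assumes A: "A \<in> carrier_mat m m" and B: "B \<in> carrier_mat n n"
    and C: "C \<in> carrier_mat m m" and D: "D \<in> carrier_mat n n"
  shows "ctrace (kron A B * kron C D) = ctrace (A * C) * ctrace (B * D)"
proof -
  have "ctrace (kron A B * kron C D) = (\<Sum>i<m. \<Sum>j<n. \<Sum>i'<m. \<Sum>j'<n.
      (A $$ (i,i') * C $$ (i',i)) * (B $$ (j,j') * D $$ (j',j)))"
    unfolding ctrace_mult[OF kron_carrier[OF A B] kron_carrier[OF C D]] sum_lessThan_mult
    by (intro sum.cong refl) (simp add: kron_index[OF A B] kron_index[OF C D])
  also have "\<dots> = (\<Sum>i<m. \<Sum>j<n. (\<Sum>i'<m. A $$ (i,i') * C $$ (i',i)) * (\<Sum>j'<n. B $$ (j,j') * D $$ (j',j)))"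
    by (simp add: sum_product)
  also have "\<dots> = ctrace (A * C) * ctrace (B * D)"
    by (simp add: ctrace_mult[OF A C] ctrace_mult[OF B D] sum_product)
  finally show ?thesis .
qed

lemma ctrace_mult_sum:
  assumes "A \<in> carrier_mat d d" "\<rho> \<in> carrier_mat d d" "\<And>t. t < q \<Longrightarrow> X t \<in> carrier_mat d d"
    and "\<And>i j. i < d \<Longrightarrow> j < d \<Longrightarrow> \<rho> $$ (i,j) = (\<Sum>t<q. p t * X t $$ (i,j))"
  shows "ctrace (A * \<rho>) = (\<Sum>t<q. p t * ctrace (A * X t))"
proof -
  have "ctrace (A * \<rho>) = (\<Sum>i<d. \<Sum>j<d. \<Sum>t<q. p t * (A $$ (i,j) * X t $$ (j,i)))"
    using assms by (simp add: ctrace_mult[of _ d] sum_distrib_left mult_ac)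
  also have "\<dots> = (\<Sum>i<d. \<Sum>t<q. \<Sum>j<d. p t * (A $$ (i,j) * X t $$ (j,i)))"
    by (intro sum.cong refl sum.swap)
  also have "\<dots> = (\<Sum>t<q. \<Sum>i<d. \<Sum>j<d. p t * (A $$ (i,j) * X t $$ (j,i)))"
    by (rule sum.swap)
  also have "\<dots> = (\<Sum>t<q. p t * ctrace (A * X t))"
    using assms by (simp add: ctrace_mult[of _ d] sum_distrib_left)
  finally show ?thesis .
qed

text \<open>The factor that is traced out contributes its trace, which is 1, so the marginals are
  mixtures of the local states with the same weights.\<close>

lemma ptrace_separable:
  assumes A: "\<And>t. t < q \<Longrightarrow> \<rho>A t \<in> carrier_mat m m \<and> ctrace (\<rho>A t) = 1"
    and B: "\<And>t. t < q \<Longrightarrow> \<rho>B t \<in> carrier_mat n n \<and> ctrace (\<rho>B t) = 1"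
    and \<rho>: "\<And>a b. a < m * n \<Longrightarrow> b < m * n \<Longrightarrow> \<rho> $$ (a,b) = (\<Sum>t<q. p t * kron (\<rho>A t) (\<rho>B t) $$ (a,b))"
  shows "i < m \<Longrightarrow> i' < m \<Longrightarrow> ptrace_B m n \<rho> $$ (i,i') = (\<Sum>t<q. p t * \<rho>A t $$ (i,i'))"
    and "j < n \<Longrightarrow> j' < n \<Longrightarrow> ptrace_A m n \<rho> $$ (j,j') = (\<Sum>t<q. p t * \<rho>B t $$ (j,j'))"
proof -
  have entry: "\<rho> $$ (i * n + j, i' * n + j') = (\<Sum>t<q. p t * (\<rho>A t $$ (i,i') * \<rho>B t $$ (j,j')))"
    if "i < m" "i' < m" "j < n" "j' < n" for i i' j j'
  proof -
    have "i * n + j < m * n" "i' * n + j' < m * n" using that by (auto intro: lex_index_less)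
    then show ?thesis using A B that by (simp add: \<rho> kron_index[of _ m _ n])
  qed
  show "ptrace_B m n \<rho> $$ (i,i') = (\<Sum>t<q. p t * \<rho>A t $$ (i,i'))" if "i < m" "i' < m"
  proof -
    have "ptrace_B m n \<rho> $$ (i,i') = (\<Sum>t<q. \<Sum>j<n. p t * (\<rho>A t $$ (i,i') * \<rho>B t $$ (j,j)))"
      using that by (subst sum.swap) (simp add: ptrace_B_def entry)
    also have "\<dots> = (\<Sum>t<q. p t * \<rho>A t $$ (i,i') * (\<Sum>j<n. \<rho>B t $$ (j,j)))"
      by (simp add: sum_distrib_left mult.assoc)
    also have "\<dots> = (\<Sum>t<q. p t * \<rho>A t $$ (i,i') * ctrace (\<rho>B t))"
      using B by (intro sum.cong refl) (fastforce simp: ctrace_def)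
    finally show ?thesis using B by simp
  qed
  show "ptrace_A m n \<rho> $$ (j,j') = (\<Sum>t<q. p t * \<rho>B t $$ (j,j'))" if "j < n" "j' < n"
  proof -
    have "ptrace_A m n \<rho> $$ (j,j') = (\<Sum>t<q. \<Sum>i<m. p t * (\<rho>A t $$ (i,i) * \<rho>B t $$ (j,j')))"
      using that by (subst sum.swap) (simp add: ptrace_A_def entry)
    also have "\<dots> = (\<Sum>t<q. p t * \<rho>B t $$ (j,j') * (\<Sum>i<m. \<rho>A t $$ (i,i)))"
      by (simp add: sum_distrib_left mult_ac)
    also have "\<dots> = (\<Sum>t<q. p t * \<rho>B t $$ (j,j') * ctrace (\<rho>A t))"
      using A by (intro sum.cong refl) (fastforce simp: ctrace_def)
    finally show ?thesis using A by simp
  qed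
qed

lemma IC_POVM_cpsd:
  assumes "IC_POVM d N M x E" "r < N * M"
  shows "cpsd d (E (r div M) (r mod M))"
proof -
  have "r div M < N" using assms(2) by (rule less_mult_imp_div_less)
  moreover have "r mod M < M" using assms(1) by (simp add: IC_POVM_def NM_POVM_def)
  ultimately show ?thesis using assms(1) by (simp add: IC_POVM_def NM_POVM_def)
qed

text \<open>Used for the squared norm of a vector made of l constant entries followed by the
  statistics of a local state.\<close>

lemma sum_lessThan_append:
  fixes l m :: nat and f g :: "nat \<Rightarrow> real"
  shows "(\<Sum>r<l + m. if r < l then f r else g (r - l)) = (\<Sum>r<l. f r) + (\<Sum>r<m. g r)"
  by (induction m) auto

theorem theorem1:
  fixes dA dB NA MA NB MB l :: nat and xA xB \<mu> \<nu> :: real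
    and EA EB :: "nat \<Rightarrow> nat \<Rightarrow> complex mat" and \<rho> :: "complex mat"
  assumes "IC_POVM dA NA MA xA EA"
    and "IC_POVM dB NB MB xB EB"
    and "0 < l"
    and "density (dA*dB) \<rho>"
    and "separable dA dB \<rho>"
  shows "trace_norm (Mblock l \<mu> \<nu> (NA*MA) (NB*MB)
            (tauvec NA MA EA (ptrace_B dA dB \<rho>))
            (tauvec NB MB EB (ptrace_A dA dB \<rho>))
            (Pmat NA MA EA NB MB EB \<rho>))
    \<le> sqrt ((real l * \<mu>^2 + (real dA - 1) * (real dA ^ 2 + real MA ^ 2 * xA)
                              / (real dA * real MA * (real MA - 1)))
          * (real l * \<nu>^2 + (real dB - 1) * (real dB ^ 2 + real MB ^ 2 * xB)
                              / (real dB * real MB * (real MB - 1))))"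
proof -
  obtain q :: nat and p :: "nat \<Rightarrow> real" and \<rho>A \<rho>B where
    p: "\<And>t. t < q \<Longrightarrow> 0 \<le> p t" "(\<Sum>t<q. p t) = 1"
    and dens: "\<And>t. t < q \<Longrightarrow> density dA (\<rho>A t)" "\<And>t. t < q \<Longrightarrow> density dB (\<rho>B t)"
    and \<rho>c: "\<rho> \<in> carrier_mat (dA*dB) (dA*dB)"
    and \<rho>: "\<And>a b. a < dA*dB \<Longrightarrow> b < dA*dB \<Longrightarrow>
      \<rho> $$ (a,b) = (\<Sum>t<q. complex_of_real (p t) * kron (\<rho>A t) (\<rho>B t) $$ (a,b))"
    using assms(5) unfolding separable_def by blast
  have A: "cpsd dA (\<rho>A t)" "\<rho>A t \<in> carrier_mat dA dA" "ctrace (\<rho>A t) = 1" if "t < q" for t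
    using dens(1)[OF that] by (auto simp: density_def cpsd_carrier)
  have B: "cpsd dB (\<rho>B t)" "\<rho>B t \<in> carrier_mat dB dB" "ctrace (\<rho>B t) = 1" if "t < q" for t
    using dens(2)[OF that] by (auto simp: density_def cpsd_carrier)
  note EA = IC_POVM_cpsd[OF assms(1)] and EB = IC_POVM_cpsd[OF assms(2)]
  define \<tau> where "\<tau> = (\<lambda>t. tauvec NA MA EA (\<rho>A t))"
  define \<sigma> where "\<sigma> = (\<lambda>t. tauvec NB MB EB (\<rho>B t))"
  \<comment> \<open>The vectors whose products \<open>u t r * v t c\<close> give the t-th rank-one
    term of the block matrix: \<mu> and \<nu> repeated l times, followed by the local
    statistics.\<close>
  define u where "u = (\<lambda>t r. if r < l then \<mu> else \<tau> t (r - l))"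
  define v where "v = (\<lambda>t r. if r < l then \<nu> else \<sigma> t (r - l))"
  have tau: "tauvec NA MA EA (ptrace_B dA dB \<rho>) r = (\<Sum>t<q. p t * \<tau> t r)" if "r < NA * MA" for r
  proof -
    have "ctrace (EA (r div MA) (r mod MA) * ptrace_B dA dB \<rho>)
        = (\<Sum>t<q. complex_of_real (p t) * ctrace (EA (r div MA) (r mod MA) * \<rho>A t))"
    proof (rule ctrace_mult_sum[of _ dA])
      show "ptrace_B dA dB \<rho> $$ (i,j) = (\<Sum>t<q. complex_of_real (p t) * \<rho>A t $$ (i,j))" if "i < dA" "j < dA" for i j
        by (rule ptrace_separable(1)[of q \<rho>A dA \<rho>B]) (use A B \<rho> that in auto)
    qed (use EA[OF that] A in \<open>auto simp: cpsd_carrier ptrace_B_def\<close>)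
    then show ?thesis by (simp add: tauvec_def \<tau>_def)
  qed
  have sig: "tauvec NB MB EB (ptrace_A dA dB \<rho>) r = (\<Sum>t<q. p t * \<sigma> t r)" if "r < NB * MB" for r
  proof -
    have "ctrace (EB (r div MB) (r mod MB) * ptrace_A dA dB \<rho>)
        = (\<Sum>t<q. complex_of_real (p t) * ctrace (EB (r div MB) (r mod MB) * \<rho>B t))"
    proof (rule ctrace_mult_sum[of _ dB])
      show "ptrace_A dA dB \<rho> $$ (i,j) = (\<Sum>t<q. complex_of_real (p t) * \<rho>B t $$ (i,j))" if "i < dB" "j < dB" for i j
        by (rule ptrace_separable(2)[of q \<rho>A dA]) (use A B \<rho> that in auto)
    qed (use EB[OF that] B in \<open>auto simp: cpsd_carrier ptrace_A_def\<close>)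
    then show ?thesis by (simp add: tauvec_def \<sigma>_def)
  qed
  have P: "Pmat NA MA EA NB MB EB \<rho> $$ (r,c) = (\<Sum>t<q. p t * (\<tau> t r * \<sigma> t c))"
    if r: "r < NA * MA" and c: "c < NB * MB" for r c
  proof -
    define X where "X = EA (r div MA) (r mod MA)"
    define Y where "Y = EB (c div MB) (c mod MB)"
    have X: "cpsd dA X" "X \<in> carrier_mat dA dA" using EA[OF r] by (auto simp: X_def cpsd_carrier)
    have Y: "cpsd dB Y" "Y \<in> carrier_mat dB dB" using EB[OF c] by (auto simp: Y_def cpsd_carrier)
    have "ctrace (kron X Y * \<rho>) = (\<Sum>t<q. complex_of_real (p t) * ctrace (kron X Y * kron (\<rho>A t) (\<rho>B t)))"
      by (rule ctrace_mult_sum[OF kron_carrier[OF X(2) Y(2)] \<rho>c]) (use A B \<rho> in \<open>auto intro: kron_carrier\<close>)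
    also have "\<dots> = (\<Sum>t<q. complex_of_real (p t) * (ctrace (X * \<rho>A t) * ctrace (Y * \<rho>B t)))"
      using A B by (intro sum.cong refl) (simp add: ctrace_kron_mult[OF X(2) Y(2)])
    \<comment> \<open>The trace on the first system is real, so the real part of each product is the
      product of the real parts.\<close>
    finally have "Re (ctrace (kron X Y * \<rho>)) = (\<Sum>t<q. p t * (Re (ctrace (X * \<rho>A t)) * Re (ctrace (Y * \<rho>B t))))"
      using A B Im_ctrace_mult_cpsd[OF X(1)] by simp
    then show ?thesis using r c by (simp add: Pmat_def \<tau>_def \<sigma>_def tauvec_def X_def Y_def)
  qed
  show ?thesis
  proof (rule trace_norm_convex_rank_one_le[where q = q and p = p and u = u and v = v])
    show "ip {..<l + NA * MA} (u t) (u t) \<le> real l * \<mu>^2 + (real dA - 1) * (real dA ^ 2 + real MA ^ 2 * xA)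
        / (real dA * real MA * (real MA - 1))" if "t < q" for t
    proof -
      have "ip {..<l + NA * MA} (u t) (u t) = (\<Sum>r<l + NA * MA. if r < l then \<mu>\<^sup>2 else (\<tau> t (r - l))\<^sup>2)"
        unfolding ip_def u_def by (intro sum.cong) (auto simp: power2_eq_square)
      then show ?thesis
        using povm_index_of_coincidence[OF assms(1) dens(1)[OF that]]
        by (simp add: sum_lessThan_append[where g = "\<lambda>r. (\<tau> t r)\<^sup>2"] \<tau>_def)
    qed
    show "ip {..<l + NB * MB} (v t) (v t) \<le> real l * \<nu>^2 + (real dB - 1) * (real dB ^ 2 + real MB ^ 2 * xB)
        / (real dB * real MB * (real MB - 1))" if "t < q" for t
    proof -
      have "ip {..<l + NB * MB} (v t) (v t) = (\<Sum>r<l + NB * MB. if r < l then \<nu>\<^sup>2 else (\<sigma> t (r - l))\<^sup>2)"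
        unfolding ip_def v_def by (intro sum.cong) (auto simp: power2_eq_square)
      then show ?thesis
        using povm_index_of_coincidence[OF assms(2) dens(2)[OF that]]
        by (simp add: sum_lessThan_append[where g = "\<lambda>r. (\<sigma> t r)\<^sup>2"] \<sigma>_def)
    qed
    \<comment> \<open>The four blocks are checked separately. The corner block is \<mu> \<nu>
      because the weights sum to 1; the border blocks come from the marginals and the last one from
      \<open>P\<close>.\<close>
    fix r c assume rc: "r < l + NA * MA" "c < l + NB * MB"
    have "r - l < NA * MA" if "\<not> r < l" using that rc by auto
    moreover have "c - l < NB * MB" if "\<not> c < l" using that rc by auto
    ultimately show "Mblock l \<mu> \<nu> (NA*MA) (NB*MB) (tauvec NA MA EA (ptrace_B dA dB \<rho>))
        (tauvec NB MB EB (ptrace_A dA dB \<rho>)) (Pmat NA MA EA NB MB EB \<rho>) $$ (r,c)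
        = (\<Sum>t<q. p t * (u t r * v t c))"
      using rc p(2) by (auto simp: Mblock_def u_def v_def tau sig P mult_ac
          simp flip: sum_distrib_left sum_distrib_right)
  qed (use p in \<open>auto simp: Mblock_def\<close>)
qed

end
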